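(* Let $(\Lambda_i)_{i\ge 1}$ be a non-negative sequence with $\Lambda_1\ge 1$ such that $(\Lambda_i/i)_{i\ge 1}$ is non-decreasing, and let $(\Gamma_{i,j})_{i,j\ge 1}$ satisfy $$0\le\Gamma_{i,j}=\Gamma_{j,i}\le\Lambda_i\Lambda_j,\qquad i,j\ge 1.$$ Let $(\varphi_{i,j;k})$, $1\le i\le j-1$, $j\ge 2$, $k\ge 1$, be non-negative real numbers satisfying $$\sum_{i=1}^{j-1} i\,\varphi_{i,j;k}=j,\qquad j\ge 2,\ k\ge 1,$$ and, for some constant $\alpha_0\ge 0$, $$\varphi_{i,j;k}\le\alpha_0,\qquad 1\le i\le j-1,\ j\ge 2,\ k\ge 1.$$ Let $\psi^{\mathrm{in}}\in Y_{1,+}$ satisfy $\sum_{i=1}^\infty G_0(i)\psi_i^{\mathrm{in}}<\infty$ for some $G_0\in\mathcal{G}_{1,\infty}$, $\sum_{i=1}^\infty\Lambda_i\psi_i^{\mathrm{in}}<\infty$, and $$M_{\Lambda^2}(\psi^{\mathrm{in}}):=\sum_{i=1}^\infty\Lambda_i^2\psi_i^{\mathrm{in}}<\infty.$$ Then there exists a unique classical solution $\psi=(\psi_i)_{i\ge 1}$ to the nonlinear breakage system with initial condition $\psi^{\mathrm{in}}$ such that $$M_{\Lambda^2}(\psi(t)):=\sum_{i=1}^\infty\Lambda_i^2\psi_i(t)\le M_{\Lambda^2}(\psi^{\mathrm{in}})\qquad\text{for all } t\ge 0.$$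
   Context: All indices are positive integers. Spaces: $Y_1$ is the Banach space of real sequences $\psi=(\psi_i)_{i\ge 1}$ with $\|\psi\|_1:=\sum_{i=1}^\infty i|\psi_i|<\infty$, and $Y_{1,+}:=\{\psi\in Y_1:\psi_i\ge 0 \text{ for each } i\ge 1\}$. The class $\mathcal{G}_{1,\infty}$: $\mathcal{G}_1$ is the set of non-negative convex functions $G\in C^2([0,\infty))$ such that $G(0)=G'(0)=0$ and $G'$ is concave; $\mathcal{G}_{1,\infty}:=\{G\in\mathcal{G}_1:\lim_{\zeta\to\infty}\frac{\zeta G'(\zeta)-G(\zeta)}{\zeta}=\infty\}$. Nonlinear breakage system: $$\frac{d\psi_i}{dt}=\sum_{j=i+1}^\infty\sum_{k=1}^\infty\varphi_{i,j;k}\Gamma_{j,k}\psi_j\psi_k-(1-\delta_{i,1})\sum_{j=1}^\infty\Gamma_{i,j}\psi_i\psi_j,\qquad \psi_i(0)=\psi_i^{\mathrm{in}},\qquad i\ge 1,$$ where $\delta_{1,1}=1$ and $\delta_{i,1}=0$ for $i\ge 2$. Classical solution: a sequence $\psi=(\psi_i)_{i\ge 1}$ of non-negative functions on $[0,\infty)$ with $\psi(t)\in Y_{1,+}$ for all $t\ge 0$ such that, for each $i\ge 1$, $\psi_i\in C^1([0,\infty))$, $$(1-\delta_{i,1})\sum_{j=1}^\infty\Gamma_{i,j}\psi_i\psi_j\in C([0,\infty)),\qquad \sum_{j=i+1}^\infty\sum_{k=1}^\infty\varphi_{i,j;k}\Gamma_{j,k}\psi_j\psi_k\in C([0,\infty)),$$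 and the differential equation (for all $t\ge 0$) and the initial condition of the system are satisfied pointwise for all $i\ge 1$. *)

theory Defs
  imports "HOL-Analysis.Analysis"
begin

text \<open>
  Sequences indexed by the positive integers are functions on \<^typ>\<open>nat\<close> whose value at 0 is
  irrelevant; every sum and every condition is restricted to indices at least 1.  Since
  \<^const>\<open>infsum\<close> is 0 for non-summable families, finiteness of a series is always stated
  separately, by \<^const>\<open>summable_on\<close>.
\<close>

definition Y1 :: "(nat \<Rightarrow> real) set" where
  "Y1 = {u. (\<lambda>i. real i * \<bar>u i\<bar>) summable_on {1..}}"

definition Y1_plus :: "(nat \<Rightarrow> real) set" where
  "Y1_plus = {u \<in> Y1. \<forall>i\<ge>1. 0 \<le> u i}"

definition finite_moment :: "(nat \<Rightarrow> real) \<Rightarrow> (nat \<Rightarrow> real) \<Rightarrow> bool" where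
  "finite_moment w u \<longleftrightarrow> (\<lambda>i. w i * u i) summable_on {1..}"

definition moment :: "(nat \<Rightarrow> real) \<Rightarrow> (nat \<Rightarrow> real) \<Rightarrow> real" where
  "moment w u = (\<Sum>\<^sub>\<infinity>i\<in>{1..}. w i * u i)"

text \<open>
  Differentiability on the closed half-line \<open>[0,\<infinity>)\<close>: the derivative at 0 is the right
  derivative, and values at negative arguments play no role.
\<close>

definition hderiv :: "(real \<Rightarrow> real) \<Rightarrow> real \<Rightarrow> real" where
  "hderiv f t = vector_derivative f (at t within {0..})"

definition C1_halfline :: "(real \<Rightarrow> real) \<Rightarrow> bool" where
  "C1_halfline f \<longleftrightarrow>
     (\<forall>t\<ge>0. f differentiable (at t within {0..})) \<and> continuous_on {0..} (hderiv f)"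

definition C2_halfline :: "(real \<Rightarrow> real) \<Rightarrow> bool" where
  "C2_halfline f \<longleftrightarrow> C1_halfline f \<and> C1_halfline (hderiv f)"

definition G1 :: "(real \<Rightarrow> real) set" where
  "G1 = {G. C2_halfline G \<and> (\<forall>x\<ge>0. 0 \<le> G x) \<and> convex_on {0..} G \<and>
            G 0 = 0 \<and> hderiv G 0 = 0 \<and> concave_on {0..} (hderiv G)}"

definition G1_inf :: "(real \<Rightarrow> real) set" where
  "G1_inf = {G \<in> G1. filterlim (\<lambda>z. (z * hderiv G z - G z) / z) at_top at_top}"

text \<open>
  In the reaction terms, \<open>\<Phi> i j k\<close> stands for \<open>\<phi>\<^sub>i\<^sub>,\<^sub>j\<^sub>;\<^sub>k\<close> and is only ever evaluated
  for \<open>1 \<le> i < j\<close> and \<open>k \<ge> 1\<close>.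
\<close>

definition gain ::
  "(nat \<Rightarrow> nat \<Rightarrow> real) \<Rightarrow> (nat \<Rightarrow> nat \<Rightarrow> nat \<Rightarrow> real) \<Rightarrow> (nat \<Rightarrow> real) \<Rightarrow> nat \<Rightarrow> real" where
  "gain \<Gamma> \<Phi> u i = (\<Sum>\<^sub>\<infinity>j\<in>{i+1..}. \<Sum>\<^sub>\<infinity>k\<in>{1..}. \<Phi> i j k * \<Gamma> j k * u j * u k)"

definition gain_converges ::
  "(nat \<Rightarrow> nat \<Rightarrow> real) \<Rightarrow> (nat \<Rightarrow> nat \<Rightarrow> nat \<Rightarrow> real) \<Rightarrow> (nat \<Rightarrow> real) \<Rightarrow> nat \<Rightarrow> bool" where
  "gain_converges \<Gamma> \<Phi> u i \<longleftrightarrow>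
     (\<forall>j\<ge>i+1. (\<lambda>k. \<Phi> i j k * \<Gamma> j k * u j * u k) summable_on {1..}) \<and>
     (\<lambda>j. \<Sum>\<^sub>\<infinity>k\<in>{1..}. \<Phi> i j k * \<Gamma> j k * u j * u k) summable_on {i+1..}"

definition loss :: "(nat \<Rightarrow> nat \<Rightarrow> real) \<Rightarrow> (nat \<Rightarrow> real) \<Rightarrow> nat \<Rightarrow> real" where
  "loss \<Gamma> u i = (1 - of_bool (i = 1)) * (\<Sum>\<^sub>\<infinity>j\<in>{1..}. \<Gamma> i j * u i * u j)"

text \<open>
  For \<open>i = 1\<close> the series in the loss term carries the factor 0, so its convergence is not required.
\<close>

definition loss_converges :: "(nat \<Rightarrow> nat \<Rightarrow> real) \<Rightarrow> (nat \<Rightarrow> real) \<Rightarrow> nat \<Rightarrow> bool" where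
  "loss_converges \<Gamma> u i \<longleftrightarrow> i = 1 \<or> (\<lambda>j. \<Gamma> i j * u i * u j) summable_on {1..}"

text \<open>
  A solution is written \<open>\<psi> i t\<close>, so that \<open>\<psi> i\<close> is a function of time and \<open>\<lambda>i. \<psi> i t\<close> is the
  sequence at time \<open>t\<close>.
\<close>

definition classical_solution ::
  "(nat \<Rightarrow> nat \<Rightarrow> real) \<Rightarrow> (nat \<Rightarrow> nat \<Rightarrow> nat \<Rightarrow> real) \<Rightarrow> (nat \<Rightarrow> real) \<Rightarrow> (nat \<Rightarrow> real \<Rightarrow> real) \<Rightarrow> bool"
  where
  "classical_solution \<Gamma> \<Phi> \<psi>in \<psi> \<longleftrightarrow>
     (\<forall>i\<ge>1. \<forall>t\<ge>0. 0 \<le> \<psi> i t) \<and>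
     (\<forall>t\<ge>0. (\<lambda>i. \<psi> i t) \<in> Y1_plus) \<and>
     (\<forall>i\<ge>1.
        C1_halfline (\<psi> i) \<and>
        (\<forall>t\<ge>0. loss_converges \<Gamma> (\<lambda>l. \<psi> l t) i) \<and>
        continuous_on {0..} (\<lambda>t. loss \<Gamma> (\<lambda>l. \<psi> l t) i) \<and>
        (\<forall>t\<ge>0. gain_converges \<Gamma> \<Phi> (\<lambda>l. \<psi> l t) i) \<and>
        continuous_on {0..} (\<lambda>t. gain \<Gamma> \<Phi> (\<lambda>l. \<psi> l t) i) \<and>
        (\<forall>t\<ge>0. (\<psi> i has_real_derivative
                   gain \<Gamma> \<Phi> (\<lambda>l. \<psi> l t) i - loss \<Gamma> (\<lambda>l. \<psi> l t) i) (at t within {0..})) \<and>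
        \<psi> i 0 = \<psi>in i)"

end

theory Submission
  imports Defs
begin

text \<open>
  If \<open>w\<^sub>i / i\<close> is non-decreasing, conservation of mass in each fragmentation event gives
  \<open>\<Sum>\<^sub>i w\<^sub>i \<phi>\<^sub>i\<^sub>,\<^sub>j\<^sub>;\<^sub>k \<le> w\<^sub>j\<close>, so breakage does not increase \<open>\<Sum>\<^sub>i w\<^sub>i \<psi>\<^sub>i\<close>; this applies to \<open>w = \<Lambda>\<close> and to
  \<open>w = \<Lambda>\<^sup>2\<close>.  Freeze one factor of the quadratic reaction terms: let \<open>\<psi>\<close> evolve linearly in the
  background \<open>\<eta>\<close>, and \<open>\<psi>'\<close> in \<open>\<eta>'\<close>.  The linear part is dissipative in the weighted norm
  \<open>\<parallel>u\<parallel> = \<Sum>\<^sub>i \<Lambda>\<^sub>i \<bar>u\<^sub>i\<bar>\<close>, and changing the background costs at most \<open>2 C \<parallel>\<eta> - \<eta>'\<parallel>\<close> if \<open>C\<close> bounds the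
  \<open>\<Lambda>\<^sup>2\<close>-moments.  Hence \<open>\<psi> - \<psi>'\<close> is controlled, in the norm \<open>sup\<^sub>t exp (- 4 C t) \<parallel>\<cdot>\<parallel>\<close>, by the
  initial difference plus half of \<open>\<eta> - \<eta>'\<close>.  Taking \<open>\<eta> = \<psi>\<close>, \<open>\<eta>' = \<psi>'\<close> gives uniqueness.  For
  existence, iterate with the initial datum of the \<open>n\<close>-th step truncated to the first \<open>n\<close> sizes: a
  truncated linear system is finite and triangular, hence explicitly solvable with non-negative
  solutions, and the iterates converge because \<open>\<Lambda>\<^sub>n \<psi>\<^sub>n\<^sup>i\<^sup>n\<close> is summable.
\<close>

subsection \<open>Infinite sums and scalar analysis\<close>

lemma has_sum_product_nonneg:
  fixes f :: "'a \<Rightarrow> real" and g :: "'b \<Rightarrow> real"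
  assumes f: "f summable_on A" and g: "g summable_on B"
    and f0: "\<And>x. x \<in> A \<Longrightarrow> 0 \<le> f x" and g0: "\<And>y. y \<in> B \<Longrightarrow> 0 \<le> g y"
  shows "((\<lambda>(x, y). f x * g y) has_sum (infsum f A * infsum g B)) (A \<times> B)"
proof (rule has_sum_SigmaI)
  have 1: "((\<lambda>y. f x * g y) has_sum (f x * infsum g B)) B" for x
    by (intro has_sum_cmult_right has_sum_infsum g)
  then show "((\<lambda>y. case (x, y) of (x, y) \<Rightarrow> f x * g y) has_sum (f x * infsum g B)) B" for x
    by simp
  show 2: "((\<lambda>x. f x * infsum g B) has_sum (infsum f A * infsum g B)) A"
    by (intro has_sum_cmult_left has_sum_infsum f)
  show "(\<lambda>(x, y). f x * g y) summable_on A \<times> B"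
    using 1 by (intro summable_on_SigmaI[where g = "\<lambda>x. f x * infsum g B"] has_sum_imp_summable[OF 2])
      (auto intro!: mult_nonneg_nonneg f0 g0)
qed

lemma has_sum_finite_sum:
  fixes f :: "'i \<Rightarrow> 'a \<Rightarrow> real"
  assumes "finite F" "\<And>i. i \<in> F \<Longrightarrow> (f i has_sum s i) A"
  shows "((\<lambda>x. \<Sum>i\<in>F. f i x) has_sum (\<Sum>i\<in>F. s i)) A"
  using assms by (induction F rule: finite_induct) (auto intro!: has_sum_add)

text \<open>One unordered sum over pairs instead of an iterated one: comparison, splitting and
  linearity in the coefficients become single \<open>has_sum\<close> arguments. The slots are kept
  apart so that the second can be frozen as a background.\<close>

definition pairsum :: "(nat \<Rightarrow> nat \<Rightarrow> real) \<Rightarrow> (nat \<Rightarrow> real) \<Rightarrow> (nat \<Rightarrow> real) \<Rightarrow> real" where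
  "pairsum c u v = (\<Sum>\<^sub>\<infinity>(j, k)\<in>{1..} \<times> {1..}. c j k * u j * v k)"

lemma has_sum_imp_partial_sums_tendsto:
  fixes f :: "nat \<Rightarrow> real"
  assumes "(f has_sum s) {1..}"
  shows "(\<lambda>n. \<Sum>i = 1..n. f i) \<longlonglongrightarrow> s"
proof -
  have "filterlim (\<lambda>n. {1..n}) (finite_subsets_at_top {1..}) (sequentially :: nat filter)"
    unfolding filterlim_finite_subsets_at_top
  proof (intro allI impI)
    fix X :: "nat set" assume X: "finite X \<and> X \<subseteq> {1..}"
    then have "X \<subseteq> {1..n}" if "Max (insert 0 X) \<le> n" for n
      using that X by (auto intro: order_trans[OF Max_ge])
    then show "\<forall>\<^sub>F n in sequentially. finite {1..n} \<and> X \<subseteq> {1..n} \<and> {1..n} \<subseteq> {1..}"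
      by (intro eventually_sequentiallyI[of "Max (insert 0 X)"]) auto
  qed
  with assms show ?thesis unfolding has_sum_def by (rule filterlim_compose)
qed

lemma has_sum_restrict_initial:
  fixes f :: "nat \<Rightarrow> real"
  shows "((\<lambda>i. if i \<le> n then f i else 0) has_sum (\<Sum>i = 1..n. f i)) {1..}"
proof -
  have "(f has_sum (\<Sum>i = 1..n. f i)) {1..n}" by simp
  then show ?thesis by (subst has_sum_cong_neutral[where T = "{1..n}" and g = f]) auto
qed

text \<open>Integrating \<open>exp (l * s)\<close> gains a factor 1 / l. With
  \<open>l = 4 * C\<close> this turns the cost \<open>2 * C\<close> of a changed background into the
  contraction factor 1/2.\<close>

lemma has_integral_exp_mult:
  fixes l t :: real
  assumes "0 < l" "0 \<le> t"
  shows "((\<lambda>s. l * exp (l * s)) has_integral (exp (l * t) - 1)) {0..t}"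
proof -
  have "((\<lambda>s. l * exp (l * s)) has_integral (exp (l * t) - exp (l * 0))) {0..t}"
    using assms(2)
    by (intro fundamental_theorem_of_calculus)
      (auto simp flip: has_real_derivative_iff_has_vector_derivative intro!: derivative_eq_intros)
  then show ?thesis by simp
qed

lemma le_of_le_add_mult_eps:
  fixes A B E :: real
  assumes "\<And>e. 0 < e \<Longrightarrow> A \<le> B + e * E"
  shows "A \<le> B"
proof (rule tendsto_lowerbound)
  show "((\<lambda>e. B + e * E) \<longlongrightarrow> B) (at_right 0)"
    by (auto intro!: tendsto_eq_intros)
  show "\<forall>\<^sub>F e in at_right 0. A \<le> B + e * E"
    using assms by (auto simp: eventually_at_right_field intro: exI[of _ 1])
qed simp

text \<open>
  The smooth substitute \<open>sqrt (u\<^sup>2 + \<epsilon>\<^sup>2)\<close> for \<open>\<bar>u\<bar>\<close> has derivative \<open>u / sqrt (u\<^sup>2 + \<epsilon>\<^sup>2)\<close>, which replaces the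
  sign of \<open>u\<close> in the dissipativity estimate.
\<close>

lemma sqrt_smoothing:
  fixes u \<epsilon> :: real
  assumes "0 < \<epsilon>"
  shows "\<bar>u\<bar> \<le> sqrt (u\<^sup>2 + \<epsilon>\<^sup>2)" "sqrt (u\<^sup>2 + \<epsilon>\<^sup>2) \<le> \<bar>u\<bar> + \<epsilon>"
    "\<bar>u / sqrt (u\<^sup>2 + \<epsilon>\<^sup>2)\<bar> \<le> 1" "\<bar>u\<bar> - \<epsilon> \<le> u / sqrt (u\<^sup>2 + \<epsilon>\<^sup>2) * u"
proof -
  define r where "r = sqrt (u\<^sup>2 + \<epsilon>\<^sup>2)"
  have r2: "r\<^sup>2 = u\<^sup>2 + \<epsilon>\<^sup>2" unfolding r_def by simp
  have "0 < u\<^sup>2 + \<epsilon>\<^sup>2" using assms by (simp add: sum_power2_gt_zero_iff)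
  then have r0: "0 < r" unfolding r_def by simp
  show 1: "\<bar>u\<bar> \<le> sqrt (u\<^sup>2 + \<epsilon>\<^sup>2)" by (rule real_le_rsqrt) simp
  show "sqrt (u\<^sup>2 + \<epsilon>\<^sup>2) \<le> \<bar>u\<bar> + \<epsilon>"
    using sqrt_add_le_add_sqrt[of "u\<^sup>2" "\<epsilon>\<^sup>2"] assms by simp
  then have r_le: "r \<le> \<bar>u\<bar> + \<epsilon>" by (simp add: r_def)
  show "\<bar>u / sqrt (u\<^sup>2 + \<epsilon>\<^sup>2)\<bar> \<le> 1"
    using 1 r0 by (simp add: abs_divide flip: r_def)
  have "(\<bar>u\<bar> - \<epsilon>) * r \<le> u\<^sup>2"
  proof (cases "\<bar>u\<bar> \<le> \<epsilon>")
    case True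
    then have "(\<bar>u\<bar> - \<epsilon>) * r \<le> 0" using r0 by (intro mult_nonpos_nonneg) auto
    then show ?thesis using zero_le_power2[of u] by linarith
  next
    case False
    then have "(\<bar>u\<bar> - \<epsilon>) * r \<le> (\<bar>u\<bar> - \<epsilon>) * (\<bar>u\<bar> + \<epsilon>)" using r_le by (intro mult_left_mono) auto
    also have "\<dots> = u\<^sup>2 - \<epsilon>\<^sup>2" by (simp add: algebra_simps power2_eq_square)
    finally show ?thesis using zero_le_power2[of \<epsilon>] by linarith
  qed
  then show "\<bar>u\<bar> - \<epsilon> \<le> u / sqrt (u\<^sup>2 + \<epsilon>\<^sup>2) * u"
    unfolding r_def[symmetric] using r0 by (simp add: pos_le_divide_eq power2_eq_square)
qed

lemma integral_has_real_derivative_halfline: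
  fixes f :: "real \<Rightarrow> real"
  assumes "continuous_on {0..} f" "0 \<le> t"
  shows "((\<lambda>x. integral {0..x} f) has_real_derivative f t) (at t within {0..})"
proof -
  have "((\<lambda>x. integral {0..x} f) has_real_derivative f t) (at t within {0..t + 1})"
    using assms by (intro integral_has_real_derivative continuous_on_subset[OF assms(1)]) auto
  moreover have "at t within {0..t + 1} = at t within {0..}"
    by (rule at_within_nhd[of _ "{..<t + 1}"]) auto
  ultimately show ?thesis by simp
qed

text \<open>Variation of constants: with \<open>A\<close> a primitive of \<open>a\<close>, the
  function \<open>exp (A t) * y t\<close> has derivative \<open>exp (A t) * g t\<close>, which is
  non-negative. The explicit formula thus shows the sign of \<open>y\<close> as well.\<close>

lemma linear_ode_nonneg_solution:
  fixes a g :: "real \<Rightarrow> real"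
  assumes a: "continuous_on {0..} a" and g: "continuous_on {0..} g"
    and g0: "\<And>t. 0 \<le> t \<Longrightarrow> 0 \<le> g t" and x0: "0 \<le> x0"
  obtains y where "y 0 = x0" "\<And>t. 0 \<le> t \<Longrightarrow> 0 \<le> y t"
    "\<And>t. 0 \<le> t \<Longrightarrow> (y has_real_derivative g t - a t * y t) (at t within {0..})"
proof -
  define A where "A t = integral {0..t} a" for t
  define B where "B t = integral {0..t} (\<lambda>s. exp (A s) * g s)" for t
  define y where "y t = exp (- A t) * (x0 + B t)" for t
  have A: "(A has_real_derivative a t) (at t within {0..})" if "0 \<le> t" for t
    unfolding A_def[abs_def] using a that by (rule integral_has_real_derivative_halfline)
  then have "continuous_on {0..} A"
    by (intro DERIV_continuous_on[of _ A a]) auto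
  then have cont: "continuous_on {0..} (\<lambda>s. exp (A s) * g s)"
    by (intro continuous_intros g)
  have B: "(B has_real_derivative exp (A t) * g t) (at t within {0..})" if "0 \<le> t" for t
    unfolding B_def[abs_def] using cont that by (rule integral_has_real_derivative_halfline)
  show thesis
  proof (rule that[of y])
    show "y 0 = x0" by (simp add: y_def A_def B_def)
    show "0 \<le> y t" if "0 \<le> t" for t
    proof -
      have "continuous_on {0..t} (\<lambda>s. exp (A s) * g s)"
        by (rule continuous_on_subset[OF cont]) auto
      then have "0 \<le> B t"
        unfolding B_def using g0 by (intro integral_nonneg integrable_continuous_real) auto
      then show ?thesis unfolding y_def using x0 by simp
    qed
    show "(y has_real_derivative g t - a t * y t) (at t within {0..})" if "0 \<le> t" for t
    proof -
      have "(y has_real_derivative exp (- A t) * - a t * (x0 + B t) + exp (A t) * g t * exp (- A t)) (at t within {0..})"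
        unfolding y_def[abs_def] using A[OF that] B[OF that]
        by (auto intro!: derivative_eq_intros)
      also have "exp (- A t) * - a t * (x0 + B t) + exp (A t) * g t * exp (- A t) = g t - a t * y t"
        by (simp add: y_def exp_minus field_simps)
      finally show ?thesis .
    qed
  qed
qed

lemma pairsum_finite_support:
  assumes "\<And>j. n < j \<Longrightarrow> u j = 0" "\<And>k. m < k \<Longrightarrow> v k = 0"
  shows "pairsum c u v = (\<Sum>j = 1..n. \<Sum>k = 1..m. c j k * u j * v k)"
proof -
  have "pairsum c u v = (\<Sum>\<^sub>\<infinity>(j, k)\<in>{1..n} \<times> {1..m}. c j k * u j * v k)"
    unfolding pairsum_def using assms by (intro infsum_cong_neutral) (auto, (meson not_le)+)
  then show ?thesis by (simp add: sum.cartesian_product)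
qed

text \<open>Summing the recursion bounds each partial sum by \<open>S 0 + D\<close> plus half of the
  previous one; \<open>2 * (S 0 + D)\<close> is the fixed point of this bound and so survives the
  induction.\<close>

lemma half_recursion_summable:
  fixes S d :: "nat \<Rightarrow> real"
  assumes rec: "\<And>n. S (Suc n) = d n + S n / 2" and S0: "0 \<le> S 0" and d0: "\<And>n. 0 \<le> d n"
    and bound: "\<And>n. (\<Sum>m<n. d m) \<le> D"
  shows "0 \<le> S n" "summable S"
proof -
  show nonneg: "0 \<le> S n" for n
    by (induction n) (use S0 d0 in \<open>auto simp: rec\<close>)
  have "(\<Sum>m<n. S m) \<le> 2 * (S 0 + D)" for n
  proof (induction n)
    case 0
    then show ?case using S0 bound[of 0] by simp
  next
    case (Suc n)
    have "(\<Sum>m<Suc n. S m) = S 0 + (\<Sum>m<n. d m) + (\<Sum>m<n. S m) / 2"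
      by (subst sum.lessThan_Suc_shift) (simp add: rec sum.distrib sum_divide_distrib)
    also have "\<dots> \<le> S 0 + D + (S 0 + D)"
      using Suc bound[of n] by (intro add_mono) auto
    finally show ?case by simp
  qed
  with nonneg show "summable S" by (intro summableI_nonneg_bounded)
qed

text \<open>Makes derivatives within the half-line unique, also at the endpoint 0, so that
  \<open>hderiv\<close> can be computed.\<close>

lemma at_within_halfline_neq_bot: "0 \<le> (t :: real) \<Longrightarrow> at t within {0..} \<noteq> bot"
proof -
  assume "0 \<le> t"
  then have "at t within {t..} \<le> at t within {0..}" by (intro at_le) auto
  then show ?thesis using trivial_limit_at_right_real[of t] by (auto simp: at_within_Ici_at_right bot_unique)
qed

text \<open>Continuity is local, and near \<open>t\<close> the half-line agrees with
  \<open>{0..t + 1}\<close>. This is how uniform limits on bounded intervals yield continuity on the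
  whole half-line.\<close>

lemma continuous_on_halfline:
  fixes f :: "real \<Rightarrow> real"
  assumes "\<And>T. 0 \<le> T \<Longrightarrow> continuous_on {0..T} f"
  shows "continuous_on {0..} f"
  unfolding continuous_on_eq_continuous_within
proof
  fix t :: real assume t: "t \<in> {0..}"
  then have "continuous (at t within {0..t + 1}) f"
    using assms[of "t + 1"] by (auto simp: continuous_on_eq_continuous_within)
  moreover have "at t within {0..t + 1} = at t within {0..}"
    by (rule at_within_nhd[of _ "{..<t + 1}"]) auto
  ultimately show "continuous (at t within {0..}) f" by (simp add: continuous_within)
qed

locale nonlinear_breakage =
  fixes \<Lambda> :: "nat \<Rightarrow> real"
    and \<Gamma> :: "nat \<Rightarrow> nat \<Rightarrow> real"
    and \<Phi> :: "nat \<Rightarrow> nat \<Rightarrow> nat \<Rightarrow> real"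
    and \<alpha> :: real
  assumes Lam_nonneg: "1 \<le> i \<Longrightarrow> 0 \<le> \<Lambda> i"
    and Lam_1: "1 \<le> \<Lambda> 1"
    and Lam_mono: "mono_on {1..} (\<lambda>i. \<Lambda> i / real i)"
    and Gam_nonneg: "1 \<le> i \<Longrightarrow> 1 \<le> j \<Longrightarrow> 0 \<le> \<Gamma> i j"
    and Gam_le: "1 \<le> i \<Longrightarrow> 1 \<le> j \<Longrightarrow> \<Gamma> i j \<le> \<Lambda> i * \<Lambda> j"
    and Phi_nonneg: "1 \<le> i \<Longrightarrow> i < j \<Longrightarrow> 1 \<le> k \<Longrightarrow> 0 \<le> \<Phi> i j k"
    and Phi_mass: "2 \<le> j \<Longrightarrow> 1 \<le> k \<Longrightarrow> (\<Sum>i = 1..j - 1. real i * \<Phi> i j k) = real j"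
    and alpha_nonneg: "0 \<le> \<alpha>"
    and Phi_le: "1 \<le> i \<Longrightarrow> i < j \<Longrightarrow> 1 \<le> k \<Longrightarrow> \<Phi> i j k \<le> \<alpha>"
begin

subsection \<open>Weighted norm and bilinear reaction terms\<close>

text \<open>The weight fits the kernel bound:
  \<open>\<Gamma> j k \<le> \<Lambda> j * \<Lambda> k\<close> gives one factor
  \<open>\<Lambda>\<close> to each slot, so testing with the weight \<open>\<Lambda>\<close> pairs a
  squared weight in the first slot with this norm in the second.\<close>

definition fin_norm :: "(nat \<Rightarrow> real) \<Rightarrow> bool" where
  "fin_norm u \<longleftrightarrow> (\<lambda>i. \<Lambda> i * \<bar>u i\<bar>) summable_on {1..}"

definition wnorm :: "(nat \<Rightarrow> real) \<Rightarrow> real" where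
  "wnorm u = (\<Sum>\<^sub>\<infinity>i\<in>{1..}. \<Lambda> i * \<bar>u i\<bar>)"

lemma Lam_ratio: "1 \<le> i \<Longrightarrow> i \<le> j \<Longrightarrow> \<Lambda> i * real j \<le> \<Lambda> j * real i"
  using mono_onD[OF Lam_mono, of i j] by (simp add: divide_simps mult.commute)

lemma Lam_ge: "1 \<le> i \<Longrightarrow> real i \<le> \<Lambda> i"
  using Lam_ratio[of 1 i] mult_right_mono[OF Lam_1, of "real i"] by linarith

lemma Lam_ge_1: "1 \<le> i \<Longrightarrow> 1 \<le> \<Lambda> i"
  using Lam_ge[of i] by linarith

text \<open>\<open>\<Lambda>\<close> itself is non-decreasing because
  \<open>\<Lambda> i * i \<le> \<Lambda> i * j \<le> \<Lambda> j * i\<close>; multiplying by the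
  ratio inequality makes the squared weight admissible in
  \<open>fragments_weight_le\<close>.\<close>

lemma Lam_sq_ratio: "1 \<le> i \<Longrightarrow> i \<le> j \<Longrightarrow> (\<Lambda> i)\<^sup>2 * real j \<le> (\<Lambda> j)\<^sup>2 * real i"
proof -
  assume ij: "1 \<le> i" "i \<le> j"
  have "\<Lambda> i * real i \<le> \<Lambda> i * real j" using ij Lam_nonneg by (intro mult_left_mono) auto
  then have "\<Lambda> i * real i \<le> \<Lambda> j * real i" using Lam_ratio[OF ij] by linarith
  then have le: "\<Lambda> i \<le> \<Lambda> j" using ij by simp
  have "(\<Lambda> i)\<^sup>2 * real j = \<Lambda> i * (\<Lambda> i * real j)" by (simp add: power2_eq_square)
  also have "\<dots> \<le> \<Lambda> j * (\<Lambda> j * real i)"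
    using ij Lam_nonneg[of i] Lam_nonneg[of j] by (intro mult_mono[OF le Lam_ratio[OF ij]]) auto
  finally show ?thesis by (simp add: power2_eq_square)
qed

lemma fin_norm_diff:
  assumes "fin_norm u" "fin_norm v"
  shows "fin_norm (\<lambda>i. u i - v i)"
  unfolding fin_norm_def
proof (rule summable_on_comparison_test)
  show "(\<lambda>i. \<Lambda> i * \<bar>u i\<bar> + \<Lambda> i * \<bar>v i\<bar>) summable_on {1..}"
    using assms by (intro summable_on_add) (auto simp: fin_norm_def)
  show "\<Lambda> i * \<bar>u i - v i\<bar> \<le> \<Lambda> i * \<bar>u i\<bar> + \<Lambda> i * \<bar>v i\<bar>" if "i \<in> {1..}" for i
    using that Lam_nonneg[of i] mult_left_mono[of "\<bar>u i - v i\<bar>" "\<bar>u i\<bar> + \<bar>v i\<bar>" "\<Lambda> i"]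
    by (auto simp: algebra_simps)
qed (auto intro!: mult_nonneg_nonneg Lam_nonneg)

lemma wnorm_nonneg: "0 \<le> wnorm u"
  unfolding wnorm_def by (rule infsum_nonneg) (auto intro!: mult_nonneg_nonneg Lam_nonneg)

lemma component_le_wnorm:
  assumes "fin_norm u" "1 \<le> i"
  shows "\<bar>u i\<bar> \<le> wnorm u"
proof -
  have "1 * \<bar>u i\<bar> \<le> \<Lambda> i * \<bar>u i\<bar>"
    using Lam_ge_1[OF assms(2)] by (intro mult_right_mono) auto
  also have "\<Lambda> i * \<bar>u i\<bar> = (\<Sum>i\<in>{i}. \<Lambda> i * \<bar>u i\<bar>)" by simp
  also have "\<dots> \<le> wnorm u"
    unfolding wnorm_def using assms
    by (intro finite_sum_le_infsum) (auto simp: fin_norm_def intro!: mult_nonneg_nonneg Lam_nonneg)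
  finally show ?thesis by simp
qed

lemma wnorm_diff_le:
  assumes "fin_norm u" "fin_norm v"
  shows "wnorm (\<lambda>i. u i - v i) \<le> wnorm u + wnorm v"
proof -
  have "wnorm (\<lambda>i. u i - v i) \<le> (\<Sum>\<^sub>\<infinity>i\<in>{1..}. \<Lambda> i * \<bar>u i\<bar> + \<Lambda> i * \<bar>v i\<bar>)"
    unfolding wnorm_def
  proof (rule infsum_mono)
    show "(\<lambda>i. \<Lambda> i * \<bar>u i - v i\<bar>) summable_on {1..}"
      using fin_norm_diff[OF assms] by (simp add: fin_norm_def)
    show "(\<lambda>i. \<Lambda> i * \<bar>u i\<bar> + \<Lambda> i * \<bar>v i\<bar>) summable_on {1..}"
      using assms by (intro summable_on_add) (auto simp: fin_norm_def)
    show "\<Lambda> i * \<bar>u i - v i\<bar> \<le> \<Lambda> i * \<bar>u i\<bar> + \<Lambda> i * \<bar>v i\<bar>" if "i \<in> {1..}" for i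
      using that Lam_nonneg[of i] mult_left_mono[of "\<bar>u i - v i\<bar>" "\<bar>u i\<bar> + \<bar>v i\<bar>" "\<Lambda> i"]
      by (auto simp: algebra_simps)
  qed
  also have "\<dots> = wnorm u + wnorm v"
    unfolding wnorm_def using assms by (intro infsum_add) (auto simp: fin_norm_def)
  finally show ?thesis .
qed

section \<open>Bilinear forms with coefficients dominated by products of weights\<close>

definition coeff_bound :: "real \<Rightarrow> (nat \<Rightarrow> nat \<Rightarrow> real) \<Rightarrow> bool" where
  "coeff_bound K c \<longleftrightarrow> (\<forall>j\<ge>1. \<forall>k\<ge>1. \<bar>c j k\<bar> \<le> K * \<Lambda> j * \<Lambda> k)"

lemma pairsum_has_sum:
  assumes "coeff_bound K c" "fin_norm u" "fin_norm v"
  shows "((\<lambda>(j, k). c j k * u j * v k) has_sum pairsum c u v) ({1..} \<times> {1..})"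
    and "\<bar>pairsum c u v\<bar> \<le> K * wnorm u * wnorm v"
proof -
  let ?A = "{1..} \<times> {1..} :: (nat \<times> nat) set"
  let ?f = "\<lambda>(j, k). c j k * u j * v k"
  let ?g = "\<lambda>(j, k). (\<Lambda> j * \<bar>u j\<bar>) * (\<Lambda> k * \<bar>v k\<bar>)"
  have g: "(?g has_sum (wnorm u * wnorm v)) ?A"
    unfolding wnorm_def using assms
    by (intro has_sum_product_nonneg) (auto simp: fin_norm_def intro!: mult_nonneg_nonneg Lam_nonneg)
  then have Kg: "((\<lambda>p. K * ?g p) has_sum (K * (wnorm u * wnorm v))) ?A"
    by (rule has_sum_cmult_right)
  have le: "norm (?f p) \<le> K * ?g p" if p: "p \<in> ?A" for p
  proof -
    obtain j k where [simp]: "p = (j, k)" and jk: "1 \<le> j" "1 \<le> k" using p by auto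
    have "\<bar>c j k\<bar> * (\<bar>u j\<bar> * \<bar>v k\<bar>) \<le> (K * \<Lambda> j * \<Lambda> k) * (\<bar>u j\<bar> * \<bar>v k\<bar>)"
      using assms(1) jk by (intro mult_right_mono) (auto simp: coeff_bound_def)
    then show ?thesis by (simp add: abs_mult mult_ac)
  qed
  have "(\<lambda>p. norm (?f p)) summable_on ?A"
    by (rule Infinite_Sum.abs_summable_on_comparison_test'[OF has_sum_imp_summable[OF Kg] le])
  then have "?f summable_on ?A"
    by (rule abs_summable_summable)
  then show f: "(?f has_sum pairsum c u v) ?A"
    unfolding pairsum_def by (rule has_sum_infsum)
  have "norm (pairsum c u v) \<le> K * (wnorm u * wnorm v)"
    by (rule norm_infsum_le[OF f Kg le])
  then show "\<bar>pairsum c u v\<bar> \<le> K * wnorm u * wnorm v" by (simp add: mult_ac)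
qed

text \<open>Only the signed terms are compared, without absolute values, so the cancellation between
  gain and loss is not lost.\<close>

lemma pairsum_le_product:
  assumes "coeff_bound K c" "fin_norm u" "fin_norm v"
    and "f summable_on {1..}" "g summable_on {1..}"
    and "\<And>j. 1 \<le> j \<Longrightarrow> 0 \<le> f j" "\<And>k. 1 \<le> k \<Longrightarrow> 0 \<le> g k"
    and "\<And>j k. 1 \<le> j \<Longrightarrow> 1 \<le> k \<Longrightarrow> c j k * u j * v k \<le> f j * g k"
  shows "pairsum c u v \<le> infsum f {1..} * infsum g {1..}"
  by (rule has_sum_mono[OF pairsum_has_sum(1)[OF assms(1-3)] has_sum_product_nonneg])
    (use assms(4-8) in auto)

text \<open>The first term on the right is the linear evolution of the difference in a fixed
  background, where dissipativity acts; the second is the cost of changing the background.\<close>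

lemma pairsum_diff:
  assumes "coeff_bound K c" "fin_norm u" "fin_norm u'" "fin_norm v" "fin_norm v'"
  shows "pairsum c u v - pairsum c u' v' =
    pairsum c (\<lambda>j. u j - u' j) v + pairsum c u' (\<lambda>k. v k - v' k)"
proof -
  note hs = pairsum_has_sum(1)[OF assms(1)]
  have "((\<lambda>p. (case p of (j, k) \<Rightarrow> c j k * u' j * v' k)
      + ((case p of (j, k) \<Rightarrow> c j k * (u j - u' j) * v k)
      + (case p of (j, k) \<Rightarrow> c j k * u' j * (v k - v' k)))) has_sum
      (pairsum c u' v' + (pairsum c (\<lambda>j. u j - u' j) v + pairsum c u' (\<lambda>k. v k - v' k))))
      ({1..} \<times> {1..})"
    using assms by (intro has_sum_add hs fin_norm_diff)
  moreover have "(\<lambda>p. (case p of (j, k) \<Rightarrow> c j k * u' j * v' k)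
      + ((case p of (j, k) \<Rightarrow> c j k * (u j - u' j) * v k)
      + (case p of (j, k) \<Rightarrow> c j k * u' j * (v k - v' k)))) = (\<lambda>(j, k). c j k * u j * v k)"
    by (auto simp: fun_eq_iff algebra_simps)
  ultimately have "((\<lambda>(j, k). c j k * u j * v k) has_sum
      (pairsum c u' v' + (pairsum c (\<lambda>j. u j - u' j) v + pairsum c u' (\<lambda>k. v k - v' k))))
      ({1..} \<times> {1..})"
    by simp
  from has_sum_unique[OF this hs[OF assms(2,4)]] show ?thesis by simp
qed

lemma pairsum_diff_bound:
  assumes "coeff_bound K c" "fin_norm u" "fin_norm u'" "fin_norm v" "fin_norm v'"
  shows "\<bar>pairsum c u v - pairsum c u' v'\<bar> \<le>
    K * wnorm (\<lambda>j. u j - u' j) * wnorm v + K * wnorm u' * wnorm (\<lambda>k. v k - v' k)"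
  using pairsum_has_sum(2)[OF assms(1) fin_norm_diff[OF assms(2,3)] assms(4)]
    pairsum_has_sum(2)[OF assms(1) assms(3) fin_norm_diff[OF assms(4,5)]]
  unfolding pairsum_diff[OF assms] by linarith

lemma pairsum_linear_coeff:
  assumes "finite F" "\<And>i. i \<in> F \<Longrightarrow> coeff_bound (K i) (c i)" "fin_norm u" "fin_norm v"
  shows "pairsum (\<lambda>j k. \<Sum>i\<in>F. a i * c i j k) u v = (\<Sum>i\<in>F. a i * pairsum (c i) u v)"
proof -
  have "((\<lambda>p. \<Sum>i\<in>F. a i * (case p of (j, k) \<Rightarrow> c i j k * u j * v k)) has_sum
      (\<Sum>i\<in>F. a i * pairsum (c i) u v)) ({1..} \<times> {1..})"
    by (intro has_sum_finite_sum has_sum_cmult_right assms pairsum_has_sum(1)[OF assms(2)])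
  moreover have "(\<lambda>p. \<Sum>i\<in>F. a i * (case p of (j, k) \<Rightarrow> c i j k * u j * v k)) =
      (\<lambda>(j, k). (\<Sum>i\<in>F. a i * c i j k) * u j * v k)"
    by (auto simp: fun_eq_iff sum_distrib_right mult.assoc)
  ultimately show ?thesis unfolding pairsum_def by (simp add: infsumI)
qed

section \<open>Reaction terms as bilinear forms, and their weighted sums\<close>

definition gain_coeff :: "nat \<Rightarrow> nat \<Rightarrow> nat \<Rightarrow> real" where
  "gain_coeff i j k = (if i < j then \<Phi> i j k * \<Gamma> j k else 0)"

text \<open>Both coefficients vanish outside the range of the original sums, so gain and loss become
  forms over the same set of pairs. The condition \<open>i \<noteq> 1\<close> encodes the factor
  that removes the loss of size 1.\<close>

definition loss_coeff :: "nat \<Rightarrow> nat \<Rightarrow> nat \<Rightarrow> real" where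
  "loss_coeff i j k = (if j = i \<and> i \<noteq> 1 then \<Gamma> j k else 0)"

lemma coeff_bound_gain: "1 \<le> i \<Longrightarrow> coeff_bound \<alpha> (gain_coeff i)"
  unfolding coeff_bound_def gain_coeff_def
proof (intro allI impI)
  fix j k :: nat assume ijk: "1 \<le> i" "1 \<le> j" "1 \<le> k"
  show "\<bar>if i < j then \<Phi> i j k * \<Gamma> j k else 0\<bar> \<le> \<alpha> * \<Lambda> j * \<Lambda> k"
    using ijk mult_mono[OF Phi_le Gam_le, of i j k j k] Phi_nonneg[of i j k] Gam_nonneg[of j k]
      alpha_nonneg Lam_nonneg[of j] Lam_nonneg[of k]
    by (auto simp: abs_mult mult.assoc)
qed

lemma coeff_bound_loss: "coeff_bound 1 (loss_coeff i)"
  unfolding coeff_bound_def loss_coeff_def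
  using Gam_le Gam_nonneg Lam_nonneg by auto

definition rate :: "nat \<Rightarrow> (nat \<Rightarrow> real) \<Rightarrow> (nat \<Rightarrow> real) \<Rightarrow> real" where
  "rate i u v = pairsum (gain_coeff i) u v - pairsum (loss_coeff i) u v"

text \<open>The change that a collision of \<open>j\<close> with \<open>k\<close> causes in the sum
  over the first \<open>n\<close> sizes with weights \<open>a\<close>; testing the system with
  \<open>a\<close> thus reduces to pointwise bounds on one coefficient.\<close>

definition test_coeff :: "(nat \<Rightarrow> real) \<Rightarrow> nat \<Rightarrow> nat \<Rightarrow> nat \<Rightarrow> real" where
  "test_coeff a n j k = (\<Sum>i = 1..n. a i * (gain_coeff i j k - loss_coeff i j k))"

lemma coeff_bound_rate: "1 \<le> i \<Longrightarrow> coeff_bound (\<alpha> + 1) (\<lambda>j k. gain_coeff i j k - loss_coeff i j k)"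
  unfolding coeff_bound_def
proof (intro allI impI)
  fix j k :: nat assume "1 \<le> i" "1 \<le> j" "1 \<le> k"
  then have "\<bar>gain_coeff i j k\<bar> \<le> \<alpha> * \<Lambda> j * \<Lambda> k" "\<bar>loss_coeff i j k\<bar> \<le> 1 * \<Lambda> j * \<Lambda> k"
    using coeff_bound_gain[of i] coeff_bound_loss[of i] unfolding coeff_bound_def by blast+
  then have "\<bar>gain_coeff i j k - loss_coeff i j k\<bar> \<le> \<alpha> * \<Lambda> j * \<Lambda> k + 1 * \<Lambda> j * \<Lambda> k"
    by linarith
  then show "\<bar>gain_coeff i j k - loss_coeff i j k\<bar> \<le> (\<alpha> + 1) * \<Lambda> j * \<Lambda> k"
    by (simp add: algebra_simps)
qed

lemma rate_eq:
  assumes "1 \<le> i" "fin_norm u" "fin_norm v"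
  shows "rate i u v = pairsum (\<lambda>j k. gain_coeff i j k - loss_coeff i j k) u v"
proof -
  \<comment> \<open>A difference is a combination over the two-element index set of truth values
    with signs 1 and -1, which makes it an instance of linearity in the coefficients.\<close>
  have "pairsum (\<lambda>j k. \<Sum>b\<in>{True, False}. (if b then 1 else -1) * (if b then gain_coeff i else loss_coeff i) j k) u v
     = (\<Sum>b\<in>{True, False}. (if b then 1 else -1) * pairsum (if b then gain_coeff i else loss_coeff i) u v)"
    using assms coeff_bound_gain coeff_bound_loss
    by (intro pairsum_linear_coeff[where K = "\<lambda>b. if b then \<alpha> else 1"]) auto
  then show ?thesis by (simp add: rate_def)
qed

lemma sum_rate_eq:
  assumes "fin_norm u" "fin_norm v"
  shows "(\<Sum>i = 1..n. a i * rate i u v) = pairsum (test_coeff a n) u v"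
proof -
  have "pairsum (test_coeff a n) u v =
      (\<Sum>i = 1..n. a i * pairsum (\<lambda>j k. gain_coeff i j k - loss_coeff i j k) u v)"
    unfolding test_coeff_def
    using assms by (intro pairsum_linear_coeff[where K = "\<lambda>_. \<alpha> + 1"] coeff_bound_rate) auto
  then show ?thesis using assms by (simp add: rate_eq)
qed

section \<open>Dissipativity from conservation of mass in a fragmentation event\<close>

text \<open>Replace \<open>w i\<close> by \<open>w j * i / j\<close> and use the mass balance;
  multiplying through by \<open>j\<close> avoids the division.\<close>

lemma fragments_weight_le:
  assumes w: "\<And>i j. 1 \<le> i \<Longrightarrow> i \<le> j \<Longrightarrow> w i * real j \<le> w j * real i"
    and jk: "2 \<le> j" "1 \<le> k"
  shows "(\<Sum>i = 1..j - 1. w i * \<Phi> i j k) \<le> w j"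
proof -
  have "real j * (\<Sum>i = 1..j - 1. w i * \<Phi> i j k) = (\<Sum>i = 1..j - 1. (w i * real j) * \<Phi> i j k)"
    by (simp add: sum_distrib_left mult_ac)
  also have "\<dots> \<le> (\<Sum>i = 1..j - 1. (w j * real i) * \<Phi> i j k)"
    using jk by (intro sum_mono mult_right_mono w Phi_nonneg) auto
  also have "\<dots> = w j * (\<Sum>i = 1..j - 1. real i * \<Phi> i j k)"
    by (simp add: sum_distrib_left mult_ac)
  also have "\<dots> = real j * w j" using Phi_mass jk by simp
  finally show ?thesis using jk by simp
qed

text \<open>\<open>G\<close> collects the fragments of size at most \<open>n\<close>, and its bound
  is the mass argument. The loss appears only for sizes from 2 to \<open>n\<close>: monomers are not
  lost, and larger sizes lie outside the truncated sum. For \<open>j = 1\<close> there is no smaller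
  fragment, hence the bound 0.\<close>

lemma test_coeff_decomp:
  assumes w: "\<And>i j. 1 \<le> i \<Longrightarrow> i \<le> j \<Longrightarrow> w i * real j \<le> w j * real i"
    and w0: "\<And>i. 1 \<le> i \<Longrightarrow> 0 \<le> w i"
    and rho: "\<And>i. 1 \<le> i \<Longrightarrow> \<bar>\<rho> i\<bar> \<le> 1"
    and jk: "1 \<le> j" "1 \<le> k"
  obtains G where "test_coeff (\<lambda>i. w i * \<rho> i) n j k =
      (G - (if 2 \<le> j \<and> j \<le> n then w j * \<rho> j else 0)) * \<Gamma> j k"
    "\<bar>G\<bar> \<le> (if 2 \<le> j then w j else 0)"
proof
  define G where "G = (\<Sum>i = 1..n. if i < j then w i * \<rho> i * \<Phi> i j k else 0)"
  have "(\<Sum>i = 1..n. w i * \<rho> i * loss_coeff i j k) =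
      (\<Sum>i = 1..n. if i = j then (if j \<noteq> 1 then w j * \<rho> j * \<Gamma> j k else 0) else 0)"
    by (intro sum.cong) (auto simp: loss_coeff_def)
  also have "\<dots> = (if 2 \<le> j \<and> j \<le> n then w j * \<rho> j else 0) * \<Gamma> j k"
    using jk by (auto simp: sum.delta)
  finally have L: "(\<Sum>i = 1..n. w i * \<rho> i * loss_coeff i j k) =
      (if 2 \<le> j \<and> j \<le> n then w j * \<rho> j else 0) * \<Gamma> j k" .
  have "(\<Sum>i = 1..n. w i * \<rho> i * gain_coeff i j k) = G * \<Gamma> j k"
    unfolding G_def sum_distrib_right by (intro sum.cong) (auto simp: gain_coeff_def)
  with L show "test_coeff (\<lambda>i. w i * \<rho> i) n j k =
      (G - (if 2 \<le> j \<and> j \<le> n then w j * \<rho> j else 0)) * \<Gamma> j k"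
    unfolding test_coeff_def by (simp add: algebra_simps sum_subtractf)
  show "\<bar>G\<bar> \<le> (if 2 \<le> j then w j else 0)"
  proof (cases "2 \<le> j")
    case True
    have "\<bar>G\<bar> \<le> (\<Sum>i = 1..n. \<bar>if i < j then w i * \<rho> i * \<Phi> i j k else 0\<bar>)"
      unfolding G_def by (rule sum_abs)
    also have "\<dots> \<le> (\<Sum>i = 1..n. if i < j then w i * \<Phi> i j k else 0)"
    proof (rule sum_mono)
      fix i assume i: "i \<in> {1..n}"
      show "\<bar>if i < j then w i * \<rho> i * \<Phi> i j k else 0\<bar> \<le> (if i < j then w i * \<Phi> i j k else 0)"
        using i jk rho[of i] w0[of i] Phi_nonneg[of i j k]
        by (auto simp: abs_mult intro!: mult_right_mono mult_left_le)
    qed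
    also have "\<dots> = (\<Sum>i\<in>{1..n} \<inter> {i. i < j}. w i * \<Phi> i j k)"
      by (simp add: sum.inter_restrict)
    also have "\<dots> \<le> (\<Sum>i = 1..j - 1. w i * \<Phi> i j k)"
      using jk by (intro sum_mono2) (auto intro!: mult_nonneg_nonneg w0 Phi_nonneg)
    also have "\<dots> \<le> w j" by (rule fragments_weight_le[OF w True jk(2)])
    finally show ?thesis using True by simp
  next
    case False
    then have "G = 0" unfolding G_def by (intro sum.neutral) auto
    then show ?thesis using False by simp
  qed
qed

text \<open>Serves the term with the changed background, where no sign can be exploited: gain and
  loss each contribute \<open>w j\<close>, whence the factor 2.\<close>

lemma test_coeff_abs_le:
  assumes w: "\<And>i j. 1 \<le> i \<Longrightarrow> i \<le> j \<Longrightarrow> w i * real j \<le> w j * real i"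
    and w0: "\<And>i. 1 \<le> i \<Longrightarrow> 0 \<le> w i"
    and rho: "\<And>i. 1 \<le> i \<Longrightarrow> \<bar>\<rho> i\<bar> \<le> 1"
    and jk: "1 \<le> j" "1 \<le> k"
  shows "\<bar>test_coeff (\<lambda>i. w i * \<rho> i) n j k\<bar> \<le> 2 * w j * \<Gamma> j k"
proof -
  obtain G where G: "test_coeff (\<lambda>i. w i * \<rho> i) n j k =
      (G - (if 2 \<le> j \<and> j \<le> n then w j * \<rho> j else 0)) * \<Gamma> j k"
    "\<bar>G\<bar> \<le> (if 2 \<le> j then w j else 0)"
    by (rule test_coeff_decomp[where w = w and \<rho> = \<rho> and n = n, OF w w0 rho jk])
  have "\<bar>w j * \<rho> j\<bar> \<le> w j"
    using rho[of j] w0[of j] jk by (simp add: abs_mult mult_left_le)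
  then have "\<bar>G - (if 2 \<le> j \<and> j \<le> n then w j * \<rho> j else 0)\<bar> \<le> 2 * w j"
    using G(2) w0[of j] jk by (auto split: if_splits)
  then show ?thesis
    unfolding G(1) abs_mult using Gam_nonneg[OF jk] by (simp add: mult_right_mono)
qed

text \<open>For \<open>j \<le> n\<close> the loss is at least
  \<open>w j * (\<bar>x\<bar> - \<epsilon>)\<close> and absorbs the gain
  \<open>w j * \<bar>x\<bar>\<close> up to the smoothing error. For \<open>j > n\<close> the
  truncated sum contains no loss, so the whole gain remains.\<close>

lemma test_coeff_dissipative:
  assumes w: "\<And>i j. 1 \<le> i \<Longrightarrow> i \<le> j \<Longrightarrow> w i * real j \<le> w j * real i"
    and w0: "\<And>i. 1 \<le> i \<Longrightarrow> 0 \<le> w i"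
    and rho: "\<And>i. 1 \<le> i \<Longrightarrow> \<bar>\<rho> i\<bar> \<le> 1"
    and jk: "1 \<le> j" "1 \<le> k"
    and x: "\<bar>x\<bar> - \<epsilon> \<le> \<rho> j * x" and eps: "0 \<le> \<epsilon>"
  shows "test_coeff (\<lambda>i. w i * \<rho> i) n j k * x \<le> (if j \<le> n then \<epsilon> else \<bar>x\<bar>) * w j * \<Gamma> j k"
proof -
  obtain G where G: "test_coeff (\<lambda>i. w i * \<rho> i) n j k =
      (G - (if 2 \<le> j \<and> j \<le> n then w j * \<rho> j else 0)) * \<Gamma> j k"
    "\<bar>G\<bar> \<le> (if 2 \<le> j then w j else 0)"
    by (rule test_coeff_decomp[where w = w and \<rho> = \<rho> and n = n, OF w w0 rho jk])
  have "G * x \<le> \<bar>G\<bar> * \<bar>x\<bar>" by (metis abs_ge_self abs_mult)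
  also have "\<dots> \<le> (if 2 \<le> j then w j else 0) * \<bar>x\<bar>" using G(2) by (intro mult_right_mono) auto
  finally have Gx: "G * x \<le> (if 2 \<le> j then w j else 0) * \<bar>x\<bar>" .
  define L where "L = (if 2 \<le> j \<and> j \<le> n then w j * \<rho> j else 0)"
  have wx: "w j * (\<bar>x\<bar> - \<epsilon>) \<le> w j * (\<rho> j * x)" using x w0[of j] jk by (intro mult_left_mono) auto
  have weps: "0 \<le> w j * \<epsilon>" "0 \<le> w j * \<bar>x\<bar>" using eps w0[of j] jk by auto
  have "(G - L) * x \<le> (if j \<le> n then \<epsilon> else \<bar>x\<bar>) * w j"
  proof (cases "2 \<le> j \<and> j \<le> n")
    case True
    then show ?thesis using Gx wx by (simp add: L_def algebra_simps)
  next
    case False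
    then show ?thesis using Gx weps by (auto simp: L_def algebra_simps split: if_splits)
  qed
  then have "(G - L) * x * \<Gamma> j k \<le> (if j \<le> n then \<epsilon> else \<bar>x\<bar>) * w j * \<Gamma> j k"
    by (rule mult_right_mono[OF _ Gam_nonneg[OF jk]])
  then show ?thesis
    unfolding G(1) L_def[symmetric] by (simp only: mult.assoc mult.commute[of "\<Gamma> j k" x])
qed

subsection \<open>Stability with respect to the background\<close>

abbreviation "Lsq \<equiv> \<lambda>i. (\<Lambda> i)\<^sup>2"

text \<open>The class in which all estimates are carried out. Since
  \<open>\<Lambda> \<ge> 1\<close>, the bound on the squared moment also bounds the weighted
  norm.\<close>

definition tame :: "real \<Rightarrow> (nat \<Rightarrow> real) \<Rightarrow> bool" where
  "tame C u \<longleftrightarrow> (\<forall>i\<ge>1. 0 \<le> u i) \<and> finite_moment Lsq u \<and> moment Lsq u \<le> C"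

lemma tame_fin_norm:
  assumes "tame C u"
  shows "fin_norm u" "wnorm u \<le> C"
proof -
  have le: "\<Lambda> i * \<bar>u i\<bar> \<le> (\<Lambda> i)\<^sup>2 * u i" if "i \<in> {1..}" for i
    using assms that Lam_ge_1[of i] mult_right_mono[of 1 "\<Lambda> i" "\<Lambda> i * u i"]
    by (auto simp: tame_def power2_eq_square mult.assoc)
  show *: "fin_norm u"
    unfolding fin_norm_def
    by (rule summable_on_comparison_test[OF _ le])
      (use assms in \<open>auto simp: tame_def finite_moment_def intro!: mult_nonneg_nonneg Lam_nonneg\<close>)
  have "wnorm u \<le> moment Lsq u"
    unfolding wnorm_def moment_def
    by (rule infsum_mono[OF _ _ le]) (use assms * in \<open>auto simp: tame_def finite_moment_def fin_norm_def\<close>)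
  then show "wnorm u \<le> C" using assms by (simp add: tame_def)
qed

definition tail :: "nat \<Rightarrow> (nat \<Rightarrow> real) \<Rightarrow> real" where
  "tail n u = moment Lsq u - (\<Sum>i = 1..n. (\<Lambda> i)\<^sup>2 * u i)"

lemma tame_partial_sums:
  assumes "tame C u"
  shows "0 \<le> (\<Sum>i = 1..n. (\<Lambda> i)\<^sup>2 * u i)" "(\<Sum>i = 1..n. (\<Lambda> i)\<^sup>2 * u i) \<le> C"
    "(\<lambda>n. \<Sum>i = 1..n. (\<Lambda> i)\<^sup>2 * u i) \<longlonglongrightarrow> moment Lsq u"
    "0 \<le> tail n u" "tail n u \<le> C"
proof -
  show 0: "0 \<le> (\<Sum>i = 1..n. (\<Lambda> i)\<^sup>2 * u i)"
    using assms by (intro sum_nonneg) (auto simp: tame_def)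
  have "(\<Sum>i = 1..n. (\<Lambda> i)\<^sup>2 * u i) \<le> moment Lsq u"
    unfolding moment_def using assms
    by (intro finite_sum_le_infsum) (auto simp: tame_def finite_moment_def)
  then show "(\<Sum>i = 1..n. (\<Lambda> i)\<^sup>2 * u i) \<le> C" "0 \<le> tail n u" "tail n u \<le> C"
    using assms 0 by (auto simp: tame_def tail_def)
  show "(\<lambda>n. \<Sum>i = 1..n. (\<Lambda> i)\<^sup>2 * u i) \<longlonglongrightarrow> moment Lsq u"
    unfolding moment_def using assms
    by (intro has_sum_imp_partial_sums_tendsto has_sum_infsum) (auto simp: tame_def finite_moment_def)
qed

text \<open>The constant may depend on \<open>a\<close> and \<open>n\<close>: it only justifies
  summability, while quantitative bounds come from the decomposition into gain and loss.\<close>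

lemma coeff_bound_test_coeff: "\<exists>K. coeff_bound K (test_coeff a n)"
proof (intro exI)
  show "coeff_bound (\<Sum>i = 1..n. \<bar>a i\<bar> * (\<alpha> + 1)) (test_coeff a n)"
    unfolding coeff_bound_def
  proof (intro allI impI)
    fix j k :: nat assume jk: "1 \<le> j" "1 \<le> k"
    have "\<bar>test_coeff a n j k\<bar> \<le> (\<Sum>i = 1..n. \<bar>a i * (gain_coeff i j k - loss_coeff i j k)\<bar>)"
      unfolding test_coeff_def by (rule sum_abs)
    also have "\<dots> \<le> (\<Sum>i = 1..n. \<bar>a i\<bar> * ((\<alpha> + 1) * \<Lambda> j * \<Lambda> k))"
      unfolding abs_mult using coeff_bound_rate jk
      by (intro sum_mono mult_left_mono) (auto simp: coeff_bound_def)
    also have "\<dots> = (\<Sum>i = 1..n. \<bar>a i\<bar> * (\<alpha> + 1)) * \<Lambda> j * \<Lambda> k"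
      unfolding sum_distrib_right by (simp add: mult.assoc)
    finally show "\<bar>test_coeff a n j k\<bar> \<le> (\<Sum>i = 1..n. \<bar>a i\<bar> * (\<alpha> + 1)) * \<Lambda> j * \<Lambda> k" .
  qed
qed

text \<open>The main differential inequality. Here \<open>\<rho>\<close> stands for a smoothed sign
  of \<open>p - p'\<close>, so the left side is the derivative of a smoothed, truncated norm of the
  difference.\<close>

lemma sum_rate_diff_le:
  assumes p: "tame C p" and p': "tame C p'" and e: "tame C e" and e': "tame C e'"
    and rho: "\<And>i. 1 \<le> i \<Longrightarrow> \<bar>\<rho> i\<bar> \<le> 1"
    and x: "\<And>i. 1 \<le> i \<Longrightarrow> \<bar>p i - p' i\<bar> - \<epsilon> \<le> \<rho> i * (p i - p' i)" and eps: "0 \<le> \<epsilon>"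
  shows "(\<Sum>i = 1..n. \<Lambda> i * \<rho> i * (rate i p e - rate i p' e')) \<le>
    C * (\<epsilon> * (\<Sum>j = 1..n. (\<Lambda> j)\<^sup>2) + tail n p + tail n p') + 2 * C * wnorm (\<lambda>i. e i - e' i)"
proof -
  let ?q = "test_coeff (\<lambda>i. \<Lambda> i * \<rho> i) n"
  note fin = tame_fin_norm(1)[OF p] tame_fin_norm(1)[OF p'] tame_fin_norm(1)[OF e] tame_fin_norm(1)[OF e']
  note finx = fin_norm_diff[OF fin(1,2)] and finv = fin_norm_diff[OF fin(3,4)]
  obtain K where K: "coeff_bound K ?q" using coeff_bound_test_coeff by blast
  have C: "0 \<le> C" using wnorm_nonneg[of e] tame_fin_norm(2)[OF e] by linarith
  have "(\<Sum>i = 1..n. \<Lambda> i * \<rho> i * (rate i p e - rate i p' e')) = pairsum ?q p e - pairsum ?q p' e'"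
    using sum_rate_eq[OF fin(1,3), of "\<lambda>i. \<Lambda> i * \<rho> i" n] sum_rate_eq[OF fin(2,4), of "\<lambda>i. \<Lambda> i * \<rho> i" n]
    by (simp add: algebra_simps sum_subtractf)
  also have "\<dots> = pairsum ?q (\<lambda>i. p i - p' i) e + pairsum ?q p' (\<lambda>i. e i - e' i)"
    by (rule pairsum_diff[OF K fin])
  finally have split: "(\<Sum>i = 1..n. \<Lambda> i * \<rho> i * (rate i p e - rate i p' e')) =
    pairsum ?q (\<lambda>i. p i - p' i) e + pairsum ?q p' (\<lambda>i. e i - e' i)" .

  \<comment> \<open>Majorant in the first slot: smoothing error up to \<open>n\<close>, and beyond
    \<open>n\<close> the sum \<open>p j + p' j\<close> in place of
    \<open>\<bar>p j - p' j\<bar>\<close>, so that it sums to the two moment tails.\<close>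
  let ?f = "\<lambda>j. (if j \<le> n then \<epsilon> else p j + p' j) * (\<Lambda> j)\<^sup>2"
  have "((\<lambda>j. (\<epsilon> * (if j \<le> n then (\<Lambda> j)\<^sup>2 else 0) + ((\<Lambda> j)\<^sup>2 * p j + - (if j \<le> n then (\<Lambda> j)\<^sup>2 * p j else 0)))
      + ((\<Lambda> j)\<^sup>2 * p' j + - (if j \<le> n then (\<Lambda> j)\<^sup>2 * p' j else 0))) has_sum
      (\<epsilon> * (\<Sum>j = 1..n. (\<Lambda> j)\<^sup>2) + (moment Lsq p + - (\<Sum>i = 1..n. (\<Lambda> i)\<^sup>2 * p i)))
       + (moment Lsq p' + - (\<Sum>i = 1..n. (\<Lambda> i)\<^sup>2 * p' i))) {1..}"
    unfolding moment_def using p p'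
    by (intro has_sum_add has_sum_uminusI has_sum_restrict_initial has_sum_cmult_right has_sum_infsum)
      (auto simp: tame_def finite_moment_def)
  also have "(\<lambda>j. (\<epsilon> * (if j \<le> n then (\<Lambda> j)\<^sup>2 else 0) + ((\<Lambda> j)\<^sup>2 * p j + - (if j \<le> n then (\<Lambda> j)\<^sup>2 * p j else 0)))
      + ((\<Lambda> j)\<^sup>2 * p' j + - (if j \<le> n then (\<Lambda> j)\<^sup>2 * p' j else 0))) = ?f"
    by (auto simp: fun_eq_iff algebra_simps)
  finally have f: "(?f has_sum (\<epsilon> * (\<Sum>j = 1..n. (\<Lambda> j)\<^sup>2) + tail n p + tail n p')) {1..}"
    by (simp add: tail_def)
  have pw1: "?q j k * (p j - p' j) * e k \<le> ?f j * (\<Lambda> k * \<bar>e k\<bar>)" if jk: "1 \<le> j" "1 \<le> k" for j k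
  proof -
    have "0 \<le> p j" "0 \<le> p' j" using p p' jk by (auto simp: tame_def)
    then have abs_x: "\<bar>p j - p' j\<bar> \<le> p j + p' j" by linarith
    have "?q j k * (p j - p' j) \<le> (if j \<le> n then \<epsilon> else \<bar>p j - p' j\<bar>) * \<Lambda> j * \<Gamma> j k"
      using x rho eps jk by (intro test_coeff_dissipative Lam_ratio Lam_nonneg) auto
    also have "\<dots> \<le> (if j \<le> n then \<epsilon> else p j + p' j) * \<Lambda> j * (\<Lambda> j * \<Lambda> k)"
      using p p' eps jk Lam_nonneg Gam_le Gam_nonneg abs_x
      by (intro mult_mono) (auto simp: tame_def)
    finally have "?q j k * (p j - p' j) \<le> ?f j * \<Lambda> k" by (simp add: power2_eq_square mult_ac)
    from mult_right_mono[OF this, of "e k"] show ?thesis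
      using e jk by (simp add: tame_def mult_ac)
  qed
  have f0: "0 \<le> ?f j" if "1 \<le> j" for j using that p p' eps by (auto simp: tame_def)
  have "pairsum ?q (\<lambda>i. p i - p' i) e \<le> infsum ?f {1..} * (\<Sum>\<^sub>\<infinity>k\<in>{1..}. \<Lambda> k * \<bar>e k\<bar>)"
    by (rule pairsum_le_product[OF K finx fin(3) has_sum_imp_summable[OF f] _ f0 _ pw1])
      (use fin(3) Lam_nonneg in \<open>auto simp: fin_norm_def\<close>)
  also have "\<dots> = (\<epsilon> * (\<Sum>j = 1..n. (\<Lambda> j)\<^sup>2) + tail n p + tail n p') * wnorm e"
    unfolding infsumI[OF f] wnorm_def ..
  also have "\<dots> \<le> (\<epsilon> * (\<Sum>j = 1..n. (\<Lambda> j)\<^sup>2) + tail n p + tail n p') * C"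
    using eps tame_partial_sums(4)[OF p] tame_partial_sums(4)[OF p']
    by (intro mult_left_mono tame_fin_norm(2) e) (auto intro!: add_nonneg_nonneg mult_nonneg_nonneg sum_nonneg)
  finally have 1: "pairsum ?q (\<lambda>i. p i - p' i) e \<le> C * (\<epsilon> * (\<Sum>j = 1..n. (\<Lambda> j)\<^sup>2) + tail n p + tail n p')"
    by (simp add: mult.commute)

  \<comment> \<open>Majorant for the background term: the factor 2 and one
    \<open>\<Lambda> j\<close> come from the test coefficient, the other \<open>\<Lambda> j\<close>
    from the kernel bound.\<close>
  let ?g = "\<lambda>j. 2 * ((\<Lambda> j)\<^sup>2 * p' j)"
  have g: "(?g has_sum (2 * moment Lsq p')) {1..}"
    unfolding moment_def using p' by (intro has_sum_cmult_right has_sum_infsum) (auto simp: tame_def finite_moment_def)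
  have pw2: "?q j k * p' j * (e k - e' k) \<le> ?g j * (\<Lambda> k * \<bar>e k - e' k\<bar>)" if jk: "1 \<le> j" "1 \<le> k" for j k
  proof -
    have "\<bar>?q j k\<bar> \<le> 2 * \<Lambda> j * \<Gamma> j k"
      using rho jk by (intro test_coeff_abs_le Lam_ratio Lam_nonneg) auto
    also have "\<dots> \<le> 2 * \<Lambda> j * (\<Lambda> j * \<Lambda> k)"
      using jk Lam_nonneg Gam_le by (intro mult_left_mono) auto
    finally have "\<bar>?q j k\<bar> * (p' j * \<bar>e k - e' k\<bar>) \<le> 2 * \<Lambda> j * (\<Lambda> j * \<Lambda> k) * (p' j * \<bar>e k - e' k\<bar>)"
      using p' jk by (intro mult_right_mono) (auto simp: tame_def)
    also have "\<dots> = ?g j * (\<Lambda> k * \<bar>e k - e' k\<bar>)" by (simp add: power2_eq_square mult_ac)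
    finally have "\<bar>?q j k\<bar> * (p' j * \<bar>e k - e' k\<bar>) \<le> ?g j * (\<Lambda> k * \<bar>e k - e' k\<bar>)" .
    moreover have "?q j k * p' j * (e k - e' k) \<le> \<bar>?q j k * p' j * (e k - e' k)\<bar>" by simp
    moreover have "\<bar>?q j k * p' j * (e k - e' k)\<bar> = \<bar>?q j k\<bar> * (p' j * \<bar>e k - e' k\<bar>)"
      using p' jk by (simp add: abs_mult tame_def mult_ac)
    ultimately show ?thesis by linarith
  qed
  have "pairsum ?q p' (\<lambda>i. e i - e' i) \<le> infsum ?g {1..} * (\<Sum>\<^sub>\<infinity>k\<in>{1..}. \<Lambda> k * \<bar>e k - e' k\<bar>)"
    by (rule pairsum_le_product[OF K fin(2) finv has_sum_imp_summable[OF g] _ _ _ pw2])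
      (use finv p' Lam_nonneg in \<open>auto simp: fin_norm_def tame_def\<close>)
  also have "\<dots> = 2 * moment Lsq p' * wnorm (\<lambda>i. e i - e' i)"
    unfolding infsumI[OF g] wnorm_def ..
  also have "\<dots> \<le> 2 * C * wnorm (\<lambda>i. e i - e' i)"
    using p' wnorm_nonneg by (intro mult_right_mono) (auto simp: tame_def)
  finally show ?thesis using 1 split by linarith
qed

text \<open>The linear system in which the collision partner is taken from \<open>\<eta>\<close>.
  The original nonlinear system is the case \<open>evolves \<psi> \<psi>\<close>.\<close>

definition evolves :: "(nat \<Rightarrow> real \<Rightarrow> real) \<Rightarrow> (nat \<Rightarrow> real \<Rightarrow> real) \<Rightarrow> bool" where
  "evolves \<eta> \<psi> \<longleftrightarrow> (\<forall>i\<ge>1. \<forall>t\<ge>0.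
     (\<psi> i has_real_derivative rate i (\<lambda>l. \<psi> l t) (\<lambda>l. \<eta> l t)) (at t within {0..}))"

lemma evolves_continuous: "evolves \<eta> \<psi> \<Longrightarrow> 1 \<le> i \<Longrightarrow> continuous_on {0..} (\<psi> i)"
  unfolding evolves_def
  by (intro has_derivative_continuous_on[where f' = "\<lambda>t. (*) (rate i (\<lambda>l. \<psi> l t) (\<lambda>l. \<eta> l t))"])
    (auto simp: has_field_derivative_def)

text \<open>The moment is a pointwise limit of continuous partial sums bounded by \<open>C\<close>,
  so dominated convergence gives integrability without continuity of the moment in time; a second
  application sends the tail integrals to 0.\<close>

lemma tail_integral:
  fixes \<psi> :: "nat \<Rightarrow> real \<Rightarrow> real"
  assumes tame: "\<And>s. 0 \<le> s \<Longrightarrow> tame C (\<lambda>i. \<psi> i s)"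
    and cont: "\<And>i. 1 \<le> i \<Longrightarrow> continuous_on {0..} (\<psi> i)"
  shows "(\<lambda>s. tail n (\<lambda>i. \<psi> i s)) integrable_on {0..t}"
    and "(\<lambda>n. integral {0..t} (\<lambda>s. tail n (\<lambda>i. \<psi> i s))) \<longlonglongrightarrow> 0"
proof -
  let ?P = "\<lambda>n s. \<Sum>i = 1..n. (\<Lambda> i)\<^sup>2 * \<psi> i s"
  have "continuous_on {0..t} (\<psi> i)" if "1 \<le> i" for i
    by (rule continuous_on_subset[OF cont[OF that]]) auto
  then have "continuous_on {0..t} (?P n)" for n
    by (intro continuous_on_sum continuous_on_mult continuous_on_const) auto
  then have P: "?P n integrable_on {0..t}" for n
    by (rule integrable_continuous_real)
  have M: "(\<lambda>s. moment Lsq (\<lambda>i. \<psi> i s)) integrable_on {0..t}"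
  proof (rule dominated_convergence(1)[OF P])
    show "(\<lambda>_. C) integrable_on {0..t}" by (rule integrable_const_ivl)
    show "norm (?P k s) \<le> C" if "s \<in> {0..t}" for k s
      using tame_partial_sums(1,2)[OF tame, of s k] that by simp
    show "(\<lambda>k. ?P k s) \<longlonglongrightarrow> moment Lsq (\<lambda>i. \<psi> i s)" if "s \<in> {0..t}" for s
      using that by (intro tame_partial_sums(3)[OF tame]) simp
  qed
  show int: "(\<lambda>s. tail n (\<lambda>i. \<psi> i s)) integrable_on {0..t}" for n
    unfolding tail_def by (intro integrable_diff M P)
  have "(\<lambda>n. integral {0..t} (\<lambda>s. tail n (\<lambda>i. \<psi> i s))) \<longlonglongrightarrow> integral {0..t} (\<lambda>_. 0)"
  proof (rule dominated_convergence(2)[OF int])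
    show "(\<lambda>_. C) integrable_on {0..t}" by (rule integrable_const_ivl)
    show "norm (tail k (\<lambda>i. \<psi> i s)) \<le> C" if "s \<in> {0..t}" for k s
      using tame_partial_sums(4,5)[OF tame, of s k] that by simp
    show "(\<lambda>k. tail k (\<lambda>i. \<psi> i s)) \<longlonglongrightarrow> 0" if "s \<in> {0..t}" for s
      using tendsto_diff[OF tendsto_const tame_partial_sums(3)[OF tame, of s],
          of "moment Lsq (\<lambda>i. \<psi> i s)"] that
      by (simp add: tail_def)
  qed
  then show "(\<lambda>n. integral {0..t} (\<lambda>s. tail n (\<lambda>i. \<psi> i s))) \<longlonglongrightarrow> 0" by simp
qed

text \<open>
  The tails account for the gain of the sizes up to \<open>n\<close> from larger ones.
\<close>

lemma stability_truncated:
  assumes tame: "\<And>s. 0 \<le> s \<Longrightarrow> tame C (\<lambda>i. \<psi> i s)" "\<And>s. 0 \<le> s \<Longrightarrow> tame C (\<lambda>i. \<psi>' i s)"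
      "\<And>s. 0 \<le> s \<Longrightarrow> tame C (\<lambda>i. \<eta> i s)" "\<And>s. 0 \<le> s \<Longrightarrow> tame C (\<lambda>i. \<eta>' i s)"
    and ev: "evolves \<eta> \<psi>" "evolves \<eta>' \<psi>'"
    and C: "0 < C" and S: "\<And>s. 0 \<le> s \<Longrightarrow> wnorm (\<lambda>i. \<eta> i s - \<eta>' i s) \<le> S * exp (4 * C * s)"
    and t: "0 \<le> t" and eps: "0 < \<epsilon>"
  shows "(\<Sum>i = 1..n. \<Lambda> i * \<bar>\<psi> i t - \<psi>' i t\<bar>) \<le>
    wnorm (\<lambda>i. \<psi> i 0 - \<psi>' i 0) + S / 2 * (exp (4 * C * t) - 1)
    + C * (integral {0..t} (\<lambda>s. tail n (\<lambda>i. \<psi> i s)) + integral {0..t} (\<lambda>s. tail n (\<lambda>i. \<psi>' i s)))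
    + \<epsilon> * ((\<Sum>i = 1..n. \<Lambda> i) + C * t * (\<Sum>i = 1..n. (\<Lambda> i)\<^sup>2))"
proof -
  define u where "u i s = \<psi> i s - \<psi>' i s" for i s
  define r where "r i s = sqrt ((u i s)\<^sup>2 + \<epsilon>\<^sup>2)" for i s
  define F where "F s = (\<Sum>i = 1..n. \<Lambda> i * r i s)" for s
  define d where "d i s = rate i (\<lambda>l. \<psi> l s) (\<lambda>l. \<eta> l s) - rate i (\<lambda>l. \<psi>' l s) (\<lambda>l. \<eta>' l s)" for i s
  define F' where "F' s = (\<Sum>i = 1..n. \<Lambda> i * (u i s / r i s) * d i s)" for s
  \<comment> \<open>The last summand is \<open>2 * C * (S * exp (4 * C * s))\<close>, rewritten so
    that its integral is \<open>S / 2 * (exp (4 * C * t) - 1)\<close>.\<close>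
  define R where "R s = C * \<epsilon> * (\<Sum>i = 1..n. (\<Lambda> i)\<^sup>2) + (C * tail n (\<lambda>i. \<psi> i s) + C * tail n (\<lambda>i. \<psi>' i s))
    + S / 2 * (4 * C * exp (4 * C * s))" for s
  have "(F has_real_derivative F' s) (at s within {0..t})" if s: "s \<in> {0..t}" for s
  proof -
    have u: "(u i has_real_derivative d i s) (at s within {0..t})" if "1 \<le> i" for i
      unfolding u_def[abs_def] d_def using ev that s
      by (intro DERIV_diff) (auto simp: evolves_def intro!: DERIV_subset[of _ _ _ "{0..}" "{0..t}"])
    have pos: "0 < (u i s)\<^sup>2 + \<epsilon>\<^sup>2" for i using eps by (simp add: sum_power2_gt_zero_iff)
    have "(r i has_real_derivative u i s / r i s * d i s) (at s within {0..t})" if "1 \<le> i" for i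
      unfolding r_def[abs_def] using pos[of i]
      by (auto intro!: derivative_eq_intros u[OF that] simp: divide_simps)
    then show ?thesis
      unfolding F_def[abs_def] F'_def mult.assoc by (intro DERIV_sum DERIV_cmult) auto
  qed
  then have F: "(F' has_integral (F t - F 0)) {0..t}"
    using t by (intro fundamental_theorem_of_calculus) (auto simp flip: has_real_derivative_iff_has_vector_derivative)
  have R: "(R has_integral (C * \<epsilon> * (\<Sum>i = 1..n. (\<Lambda> i)\<^sup>2)) * (t - 0)
    + (C * integral {0..t} (\<lambda>s. tail n (\<lambda>i. \<psi> i s)) + C * integral {0..t} (\<lambda>s. tail n (\<lambda>i. \<psi>' i s)))
    + S / 2 * (exp (4 * C * t) - 1)) {0..t}"
    unfolding R_def[abs_def]
    using has_integral_const_real[of "C * \<epsilon> * (\<Sum>i = 1..n. (\<Lambda> i)\<^sup>2)" 0 t] t C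
    by (intro has_integral_add has_integral_mult_right integrable_integral has_integral_exp_mult
        tail_integral(1)[OF tame(1) evolves_continuous[OF ev(1)]]
        tail_integral(1)[OF tame(2) evolves_continuous[OF ev(2)]])
      (auto simp: mult.commute)
  have "F' s \<le> R s" if s: "s \<in> {0..t}" for s
  proof -
    have s0: "0 \<le> s" using s by simp
    have "F' s \<le> C * (\<epsilon> * (\<Sum>j = 1..n. (\<Lambda> j)\<^sup>2) + tail n (\<lambda>i. \<psi> i s) + tail n (\<lambda>i. \<psi>' i s))
        + 2 * C * wnorm (\<lambda>i. \<eta> i s - \<eta>' i s)"
      unfolding F'_def d_def
      using eps sqrt_smoothing(3,4)[OF eps]
      by (intro sum_rate_diff_le tame s0) (auto simp: r_def u_def)
    also have "\<dots> \<le> C * (\<epsilon> * (\<Sum>j = 1..n. (\<Lambda> j)\<^sup>2) + tail n (\<lambda>i. \<psi> i s) + tail n (\<lambda>i. \<psi>' i s))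
        + 2 * C * (S * exp (4 * C * s))"
      using C S[OF s0] by (intro add_left_mono mult_left_mono) auto
    also have "\<dots> = R s" by (simp add: R_def algebra_simps)
    finally show ?thesis .
  qed
  from has_integral_le[OF F R this] have FR: "F t - F 0 \<le> (C * \<epsilon> * (\<Sum>i = 1..n. (\<Lambda> i)\<^sup>2)) * (t - 0)
    + (C * integral {0..t} (\<lambda>s. tail n (\<lambda>i. \<psi> i s)) + C * integral {0..t} (\<lambda>s. tail n (\<lambda>i. \<psi>' i s)))
    + S / 2 * (exp (4 * C * t) - 1)" by blast
  have "(\<Sum>i = 1..n. \<Lambda> i * \<bar>\<psi> i t - \<psi>' i t\<bar>) \<le> F t"
    unfolding F_def r_def u_def using sqrt_smoothing(1)[OF eps] Lam_nonneg
    by (intro sum_mono mult_left_mono) auto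
  moreover have "F 0 \<le> (\<Sum>i = 1..n. \<Lambda> i * (\<bar>\<psi> i 0 - \<psi>' i 0\<bar> + \<epsilon>))"
    unfolding F_def r_def u_def using sqrt_smoothing(2)[OF eps] Lam_nonneg
    by (intro sum_mono mult_left_mono) auto
  moreover have "(\<Sum>i = 1..n. \<Lambda> i * (\<bar>\<psi> i 0 - \<psi>' i 0\<bar> + \<epsilon>)) =
      (\<Sum>i = 1..n. \<Lambda> i * \<bar>\<psi> i 0 - \<psi>' i 0\<bar>) + \<epsilon> * (\<Sum>i = 1..n. \<Lambda> i)"
    by (simp add: distrib_left sum.distrib sum_distrib_left mult.commute)
  moreover have "(\<Sum>i = 1..n. \<Lambda> i * \<bar>\<psi> i 0 - \<psi>' i 0\<bar>) \<le> wnorm (\<lambda>i. \<psi> i 0 - \<psi>' i 0)"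
    unfolding wnorm_def
    using fin_norm_diff[OF tame_fin_norm(1)[OF tame(1)] tame_fin_norm(1)[OF tame(2)], of 0 0] Lam_nonneg
    by (intro finite_sum_le_infsum) (auto simp: fin_norm_def)
  ultimately show ?thesis using FR by (simp add: algebra_simps)
qed

text \<open>The backgrounds enter only through \<open>S\<close>, and the output carries half of it:
  this contraction drives both the iteration and uniqueness.\<close>

lemma stability:
  assumes tame: "\<And>s. 0 \<le> s \<Longrightarrow> tame C (\<lambda>i. \<psi> i s)" "\<And>s. 0 \<le> s \<Longrightarrow> tame C (\<lambda>i. \<psi>' i s)"
      "\<And>s. 0 \<le> s \<Longrightarrow> tame C (\<lambda>i. \<eta> i s)" "\<And>s. 0 \<le> s \<Longrightarrow> tame C (\<lambda>i. \<eta>' i s)"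
    and ev: "evolves \<eta> \<psi>" "evolves \<eta>' \<psi>'"
    and C: "0 < C" and S0: "0 \<le> S"
    and S: "\<And>s. 0 \<le> s \<Longrightarrow> wnorm (\<lambda>i. \<eta> i s - \<eta>' i s) \<le> S * exp (4 * C * s)"
    and t: "0 \<le> t"
  shows "wnorm (\<lambda>i. \<psi> i t - \<psi>' i t) \<le> wnorm (\<lambda>i. \<psi> i 0 - \<psi>' i 0) + S / 2 * exp (4 * C * t)"
proof -
  let ?B = "wnorm (\<lambda>i. \<psi> i 0 - \<psi>' i 0) + S / 2 * (exp (4 * C * t) - 1)"
  let ?I = "\<lambda>n. C * (integral {0..t} (\<lambda>s. tail n (\<lambda>i. \<psi> i s)) + integral {0..t} (\<lambda>s. tail n (\<lambda>i. \<psi>' i s)))"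
  have "(\<Sum>i = 1..n. \<Lambda> i * \<bar>\<psi> i t - \<psi>' i t\<bar>) \<le> ?B + ?I n" for n
    \<comment> \<open>The smoothing is removed at fixed \<open>n\<close>, before \<open>n\<close>
      tends to infinity, since its coefficient contains sums of weights that grow with
      \<open>n\<close>.\<close>
    by (rule le_of_le_add_mult_eps, rule stability_truncated[OF tame ev C S t])
  moreover have "(\<lambda>n. ?B + ?I n) \<longlonglongrightarrow> ?B + C * (0 + 0)"
    by (intro tendsto_intros tail_integral(2)[OF tame(1)] tail_integral(2)[OF tame(2)]
        evolves_continuous[OF ev(1)] evolves_continuous[OF ev(2)])
  moreover have "(\<lambda>n. \<Sum>i = 1..n. \<Lambda> i * \<bar>\<psi> i t - \<psi>' i t\<bar>) \<longlonglongrightarrow> wnorm (\<lambda>i. \<psi> i t - \<psi>' i t)"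
    unfolding wnorm_def
    using fin_norm_diff[OF tame_fin_norm(1)[OF tame(1)] tame_fin_norm(1)[OF tame(2)], OF t t]
    by (intro has_sum_imp_partial_sums_tendsto has_sum_infsum) (auto simp: fin_norm_def)
  ultimately have "wnorm (\<lambda>i. \<psi> i t - \<psi>' i t) \<le> ?B + C * (0 + 0)"
    by (intro LIMSEQ_le) auto
  then show ?thesis using S0 by (simp add: algebra_simps)
qed

subsection \<open>Finite triangular systems\<close>

lemma fin_norm_finite_support: "(\<And>i. n < i \<Longrightarrow> u i = 0) \<Longrightarrow> fin_norm u"
  unfolding fin_norm_def
  by (rule finite_nonzero_values_imp_summable_on, rule finite_subset[of _ "{..n}"]) (auto simp: not_le[symmetric])

lemma moment_finite_support:
  assumes "\<And>i. n < i \<Longrightarrow> u i = 0"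
  shows "finite_moment w u" "moment w u = (\<Sum>i = 1..n. w i * u i)"
proof -
  have "((\<lambda>i. if i \<le> n then w i * u i else 0) has_sum (\<Sum>i = 1..n. w i * u i)) {1..}"
    by (rule has_sum_restrict_initial)
  also have "(\<lambda>i. if i \<le> n then w i * u i else 0) = (\<lambda>i. w i * u i)"
    using assms by (auto simp: fun_eq_iff)
  finally show "finite_moment w u" "moment w u = (\<Sum>i = 1..n. w i * u i)"
    by (auto simp: finite_moment_def moment_def has_sum_imp_summable infsumI)
qed

lemma rate_finite_support:
  assumes i: "1 \<le> i" and u: "\<And>j. n < j \<Longrightarrow> u j = 0" and v: "\<And>k. m < k \<Longrightarrow> v k = 0"
  shows "rate i u v = (\<Sum>j = i + 1..n. \<Sum>k = 1..m. \<Phi> i j k * \<Gamma> j k * u j * v k)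
    - (\<Sum>k = 1..m. (if i \<noteq> 1 then \<Gamma> i k else 0) * v k) * u i"
proof -
  have "pairsum (gain_coeff i) u v = (\<Sum>j = 1..n. \<Sum>k = 1..m. gain_coeff i j k * u j * v k)"
    by (rule pairsum_finite_support[OF u v])
  also have "\<dots> = (\<Sum>j = i + 1..n. \<Sum>k = 1..m. gain_coeff i j k * u j * v k)"
    using i by (intro sum.mono_neutral_right) (auto simp: gain_coeff_def)
  also have "\<dots> = (\<Sum>j = i + 1..n. \<Sum>k = 1..m. \<Phi> i j k * \<Gamma> j k * u j * v k)"
    by (intro sum.cong) (auto simp: gain_coeff_def)
  finally have 1: "pairsum (gain_coeff i) u v = (\<Sum>j = i + 1..n. \<Sum>k = 1..m. \<Phi> i j k * \<Gamma> j k * u j * v k)" .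
  have "pairsum (loss_coeff i) u v = (\<Sum>j = 1..n. \<Sum>k = 1..m. loss_coeff i j k * u j * v k)"
    by (rule pairsum_finite_support[OF u v])
  also have "\<dots> = (\<Sum>j = 1..n. if j = i then (\<Sum>k = 1..m. (if i \<noteq> 1 then \<Gamma> i k else 0) * u i * v k) else 0)"
    by (intro sum.cong) (auto simp: loss_coeff_def)
  also have "\<dots> = (\<Sum>k = 1..m. (if i \<noteq> 1 then \<Gamma> i k else 0) * u i * v k)"
    using i u[of i] by (simp add: sum.delta)
  also have "\<dots> = (\<Sum>k = 1..m. (if i \<noteq> 1 then \<Gamma> i k else 0) * v k) * u i"
    unfolding sum_distrib_right by (simp add: mult_ac)
  finally show ?thesis unfolding rate_def 1 by simp
qed

text \<open>The equation for size \<open>i\<close> involves only larger sizes in its gain and is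
  linear in \<open>\<psi> i\<close>, so the sizes are solved one at a time from \<open>N\<close>
  downwards.\<close>

lemma triangular_system_solution:
  fixes \<eta> :: "nat \<Rightarrow> real \<Rightarrow> real"
  assumes eta0: "\<And>i t. 1 \<le> i \<Longrightarrow> 0 \<le> t \<Longrightarrow> 0 \<le> \<eta> i t"
    and eta_supp: "\<And>i t. m < i \<Longrightarrow> \<eta> i t = 0"
    and eta_cont: "\<And>i. 1 \<le> i \<Longrightarrow> continuous_on {0..} (\<eta> i)"
    and c: "\<And>i. 1 \<le> i \<Longrightarrow> 0 \<le> c i"
  obtains \<psi> where "evolves \<eta> \<psi>" "\<And>i t. 1 \<le> i \<Longrightarrow> 0 \<le> t \<Longrightarrow> 0 \<le> \<psi> i t"
    "\<And>i t. N < i \<Longrightarrow> \<psi> i t = 0" "\<And>i. 1 \<le> i \<Longrightarrow> i \<le> N \<Longrightarrow> \<psi> i 0 = c i"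
proof -
  define a where "a i t = (\<Sum>k = 1..m. (if i \<noteq> 1 then \<Gamma> i k else 0) * \<eta> k t)" for i t
  define g where "g \<psi> i t = (\<Sum>j = i + 1..N. \<Sum>k = 1..m. \<Phi> i j k * \<Gamma> j k * \<psi> j t * \<eta> k t)"
    for \<psi> :: "nat \<Rightarrow> real \<Rightarrow> real" and i t
  define good where "good \<psi> i \<longleftrightarrow> \<psi> i 0 = c i \<and> (\<forall>t\<ge>0. 0 \<le> \<psi> i t) \<and>
      (\<forall>t\<ge>0. (\<psi> i has_real_derivative g \<psi> i t - a i t * \<psi> i t) (at t within {0..}))"
    for \<psi> :: "nat \<Rightarrow> real \<Rightarrow> real" and i
  \<comment> \<open>Induction on the number \<open>d\<close> of top sizes already solved; for
    \<open>d = N\<close> the condition \<open>N < i + d\<close> holds for every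
    \<open>i \<ge> 1\<close>.\<close>
  have "\<exists>\<psi>. (\<forall>i>N. \<psi> i = (\<lambda>_. 0)) \<and> (\<forall>i. 1 \<le> i \<and> i \<le> N \<and> N < i + d \<longrightarrow> good \<psi> i)" for d
  proof (induction d)
    case 0
    show ?case by (intro exI[of _ "\<lambda>_ _. 0"]) auto
  next
    case (Suc d)
    then obtain \<psi> where psi: "\<And>i. N < i \<Longrightarrow> \<psi> i = (\<lambda>_. 0)"
      "\<And>i. 1 \<le> i \<Longrightarrow> i \<le> N \<Longrightarrow> N < i + d \<Longrightarrow> good \<psi> i" by blast
    show ?case
    proof (cases "d < N")
      case False
      then show ?thesis using psi by (intro exI[of _ \<psi>]) auto
    next
      case True
      define l where "l = N - d"
      have l: "1 \<le> l" "l \<le> N" using True by (auto simp: l_def)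
      have good: "good \<psi> j" if "l < j" "j \<le> N" for j
        using that True by (intro psi(2)) (auto simp: l_def)
      have cont: "continuous_on {0..} (\<psi> j)" if "l < j" "j \<le> N" for j
        using good[OF that] unfolding good_def
        by (intro DERIV_continuous_on[of _ _ "\<lambda>t. g \<psi> j t - a j t * \<psi> j t"]) auto
      have ca: "continuous_on {0..} (a l)"
        unfolding a_def[abs_def] by (intro continuous_intros eta_cont) auto
      have cg: "continuous_on {0..} (g \<psi> l)"
        unfolding g_def[abs_def] by (intro continuous_intros eta_cont cont) auto
      have g0: "0 \<le> g \<psi> l t" if "0 \<le> t" for t
        unfolding g_def using that good l
        by (intro sum_nonneg mult_nonneg_nonneg eta0 Phi_nonneg Gam_nonneg) (auto simp: good_def)
      obtain y where y: "y 0 = c l" "\<And>t. 0 \<le> t \<Longrightarrow> 0 \<le> y t"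
        "\<And>t. 0 \<le> t \<Longrightarrow> (y has_real_derivative g \<psi> l t - a l t * y t) (at t within {0..})"
        using linear_ode_nonneg_solution[OF ca cg g0 c[OF l(1)]] by blast
      define \<psi>' where "\<psi>' = \<psi>(l := y)"
      \<comment> \<open>Overwriting component \<open>l\<close> leaves the equations of sizes
        \<open>i \<ge> l\<close> intact, because their gain uses only indices above
        \<open>i\<close>.\<close>
      have g_eq: "g \<psi>' i t = g \<psi> i t" if "l \<le> i" for i t
        unfolding g_def \<psi>'_def using that by (intro sum.cong) auto
      have "good \<psi>' l" using y by (simp add: good_def g_eq) (simp add: \<psi>'_def)
      moreover have "good \<psi>' i" if "l < i" "i \<le> N" for i
        using good[OF that] that by (simp add: good_def g_eq) (simp add: \<psi>'_def)
      ultimately have "good \<psi>' i" if "l \<le> i" "i \<le> N" for i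
        using that by (cases "i = l") auto
      moreover have "\<psi>' i = (\<lambda>_. 0)" if "N < i" for i
        using that psi(1) l by (simp add: \<psi>'_def)
      ultimately show ?thesis
        using l by (intro exI[of _ \<psi>']) (auto simp: l_def)
    qed
  qed
  from this[of N] obtain \<psi> where sol: "\<forall>i>N. \<psi> i = (\<lambda>_. 0)"
    "\<forall>i. 1 \<le> i \<and> i \<le> N \<and> N < i + N \<longrightarrow> good \<psi> i" by blast
  then have psi: "\<psi> i = (\<lambda>_. 0)" if "N < i" for i using that by blast
  have psi_good: "good \<psi> i" if "1 \<le> i" "i \<le> N" for i using that sol(2) by simp
  have rate: "rate i (\<lambda>l. \<psi> l t) (\<lambda>l. \<eta> l t) = g \<psi> i t - a i t * \<psi> i t" if "1 \<le> i" for i t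
    unfolding g_def a_def using that psi eta_supp by (intro rate_finite_support) auto
  show thesis
  proof (rule that[of \<psi>])
    show "evolves \<eta> \<psi>"
      unfolding evolves_def
    proof (intro allI impI)
      fix i :: nat and t :: real assume i: "1 \<le> i" and t: "0 \<le> t"
      show "(\<psi> i has_real_derivative rate i (\<lambda>l. \<psi> l t) (\<lambda>l. \<eta> l t)) (at t within {0..})"
      proof (cases "i \<le> N")
        case True
        then show ?thesis using psi_good[OF i] t by (simp add: rate[OF i] good_def)
      next
        case False
        then have "g \<psi> i t = 0" unfolding g_def by simp
        then show ?thesis using False psi[of i] by (simp add: rate[OF i])
      qed
    qed
    show "0 \<le> \<psi> i t" if "1 \<le> i" "0 \<le> t" for i t
      using psi[of i] psi_good[of i] that by (cases "i \<le> N") (auto simp: good_def)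
    show "\<psi> i t = 0" if "N < i" for i t using psi[OF that] by simp
    show "\<psi> i 0 = c i" if "1 \<le> i" "i \<le> N" for i using psi_good[OF that] by (simp add: good_def)
  qed
qed

text \<open>Dissipativity with squared weight, \<open>\<rho> = 1\<close> and
  \<open>\<epsilon> = 0\<close>. The uncompensated gain from sizes above \<open>N\<close> is absent
  because of the support, so every term of the pair sum is at most 0.\<close>

lemma square_moment_nonincreasing:
  assumes ev: "evolves \<eta> \<psi>" and psi0: "\<And>i t. 1 \<le> i \<Longrightarrow> 0 \<le> t \<Longrightarrow> 0 \<le> \<psi> i t"
    and supp: "\<And>i t. N < i \<Longrightarrow> \<psi> i t = 0"
    and eta0: "\<And>i t. 1 \<le> i \<Longrightarrow> 0 \<le> t \<Longrightarrow> 0 \<le> \<eta> i t"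
    and eta_fin: "\<And>t. 0 \<le> t \<Longrightarrow> fin_norm (\<lambda>i. \<eta> i t)"
    and t: "0 \<le> t"
  shows "(\<Sum>i = 1..N. (\<Lambda> i)\<^sup>2 * \<psi> i t) \<le> (\<Sum>i = 1..N. (\<Lambda> i)\<^sup>2 * \<psi> i 0)"
proof -
  define F where "F s = (\<Sum>i = 1..N. (\<Lambda> i)\<^sup>2 * \<psi> i s)" for s
  define F' where "F' s = (\<Sum>i = 1..N. (\<Lambda> i)\<^sup>2 * rate i (\<lambda>l. \<psi> l s) (\<lambda>l. \<eta> l s))" for s
  have "(F has_real_derivative F' s) (at s within {0..t})" if s: "s \<in> {0..t}" for s
    unfolding F_def[abs_def] F'_def using ev s
    by (intro DERIV_sum DERIV_cmult) (auto simp: evolves_def intro!: DERIV_subset[of _ _ _ "{0..}" "{0..t}"])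
  then have F: "(F' has_integral (F t - F 0)) {0..t}"
    using t by (intro fundamental_theorem_of_calculus) (auto simp flip: has_real_derivative_iff_has_vector_derivative)
  have "F' s \<le> 0" if s: "s \<in> {0..t}" for s
  proof -
    let ?a = "\<lambda>i. (\<Lambda> i)\<^sup>2 * 1" and ?u = "\<lambda>i. \<psi> i s" and ?v = "\<lambda>i. \<eta> i s"
    have s0: "0 \<le> s" using s by simp
    have u: "fin_norm ?u" by (rule fin_norm_finite_support[of N]) (rule supp)
    obtain K where K: "coeff_bound K (test_coeff ?a N)" using coeff_bound_test_coeff by blast
    have "F' s = pairsum (test_coeff ?a N) ?u ?v"
      unfolding F'_def using sum_rate_eq[OF u eta_fin[OF s0], of ?a N] by simp
    also have "\<dots> \<le> infsum (\<lambda>_. 0) {1::nat..} * infsum (\<lambda>_. 0) {1::nat..}"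
    proof (rule pairsum_le_product[OF K u eta_fin[OF s0]])
      fix j k :: nat assume jk: "1 \<le> j" "1 \<le> k"
      show "test_coeff ?a N j k * ?u j * ?v k \<le> 0 * 0"
      proof (cases "j \<le> N")
        case True
        have "test_coeff ?a N j k * ?u j \<le> (if j \<le> N then 0 else \<bar>?u j\<bar>) * (\<Lambda> j)\<^sup>2 * \<Gamma> j k"
          using jk psi0 s0 by (intro test_coeff_dissipative Lam_sq_ratio) auto
        then show ?thesis using True eta0[OF jk(2) s0] by (simp add: mult_nonpos_nonneg)
      next
        case False
        then show ?thesis by (simp add: supp)
      qed
    qed auto
    finally show ?thesis by simp
  qed
  from has_integral_le[OF F has_integral_0 this] show ?thesis by (simp add: F_def)
qed

subsection \<open>Picard iteration\<close>

lemma tame_mono: "tame C u \<Longrightarrow> C \<le> D \<Longrightarrow> tame D u"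
  by (auto simp: tame_def)

text \<open>Lets moment bounds survive componentwise limits: only finite sums have to pass to the
  limit, as in Fatou's lemma.\<close>

lemma tameI_partial_sums:
  assumes nonneg: "\<And>i. 1 \<le> i \<Longrightarrow> 0 \<le> u i" and le: "\<And>n. (\<Sum>i = 1..n. (\<Lambda> i)\<^sup>2 * u i) \<le> C"
  shows "tame C u"
proof -
  have F: "(\<Sum>i\<in>F. (\<Lambda> i)\<^sup>2 * u i) \<le> C" if "finite F" "F \<subseteq> {1..}" for F
  proof -
    have "(\<Sum>i\<in>F. (\<Lambda> i)\<^sup>2 * u i) \<le> (\<Sum>i = 1..Max (insert 0 F). (\<Lambda> i)\<^sup>2 * u i)"
      using that nonneg by (intro sum_mono2) auto
    then show ?thesis using le order_trans by blast
  qed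
  have "(\<lambda>i. (\<Lambda> i)\<^sup>2 * u i) summable_on {1..}"
    using nonneg F by (intro nonneg_bdd_above_summable_on bdd_aboveI2[where M = C]) auto
  then show ?thesis
    using nonneg F by (auto simp: tame_def finite_moment_def moment_def intro!: infsum_le_finite_sums)
qed

lemma wnorm_minus_commute: "wnorm (\<lambda>i. u i - v i) = wnorm (\<lambda>i. v i - u i)"
  unfolding wnorm_def by (simp add: abs_minus_commute)

lemma wnorm_triangle:
  assumes "fin_norm u" "fin_norm v" "fin_norm w"
  shows "wnorm (\<lambda>i. u i - w i) \<le> wnorm (\<lambda>i. u i - v i) + wnorm (\<lambda>i. v i - w i)"
  using wnorm_diff_le[OF fin_norm_diff[OF assms(1,2)] fin_norm_diff[OF assms(3,2)]]
  by (simp add: wnorm_minus_commute[of w v])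

lemma partial_sum_le_wnorm: "fin_norm u \<Longrightarrow> (\<Sum>i = 1..n. \<Lambda> i * \<bar>u i\<bar>) \<le> wnorm u"
  unfolding wnorm_def using Lam_nonneg by (intro finite_sum_le_infsum) (auto simp: fin_norm_def)

text \<open>The invariant of the iteration: the truncated datum keeps the support finite, while the
  moment bound is the same for all \<open>n\<close>.\<close>

definition approximant :: "(nat \<Rightarrow> real) \<Rightarrow> nat \<Rightarrow> (nat \<Rightarrow> real \<Rightarrow> real) \<Rightarrow> bool" where
  "approximant x0 n \<psi> \<longleftrightarrow> (\<forall>i\<ge>1. continuous_on {0..} (\<psi> i)) \<and> (\<forall>i>n. \<forall>t. \<psi> i t = 0) \<and>
     (\<forall>i. 1 \<le> i \<and> i \<le> n \<longrightarrow> \<psi> i 0 = x0 i) \<and> (\<forall>t\<ge>0. tame (moment Lsq x0) (\<lambda>i. \<psi> i t))"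

lemma approximants_exist:
  assumes x0: "tame (moment Lsq x0) x0"
  obtains X where "\<And>n. approximant x0 n (X n)" "\<And>n. evolves (X n) (X (Suc n))"
proof -
  have "\<exists>X. \<forall>n. approximant x0 n (X n) \<and> evolves (X n) (X (Suc n))"
  proof (rule dependent_nat_choice)
    have "tame (moment Lsq x0) (\<lambda>i. 0)"
      using tame_partial_sums(2)[OF x0, of 0] by (intro tameI_partial_sums) auto
    then show "\<exists>\<psi>. approximant x0 0 \<psi>"
      by (intro exI[of _ "\<lambda>_ _. 0"]) (auto simp: approximant_def)
  next
    fix \<eta> n assume eta: "approximant x0 n \<eta>"
    have eta0: "0 \<le> \<eta> i t" if "1 \<le> i" "0 \<le> t" for i t
      using eta that by (auto simp: approximant_def tame_def)
    have eta_supp: "\<eta> i t = 0" if "n < i" for i t using eta that by (auto simp: approximant_def)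
    have eta_cont: "continuous_on {0..} (\<eta> i)" if "1 \<le> i" for i
      using eta that by (auto simp: approximant_def)
    have x0_nonneg: "0 \<le> x0 i" if "1 \<le> i" for i using x0 that by (auto simp: tame_def)
    obtain \<psi> where ev: "evolves \<eta> \<psi>" and psi0: "\<And>i t. 1 \<le> i \<Longrightarrow> 0 \<le> t \<Longrightarrow> 0 \<le> \<psi> i t"
      and supp: "\<And>i t. Suc n < i \<Longrightarrow> \<psi> i t = 0"
      and init: "\<And>i. 1 \<le> i \<Longrightarrow> i \<le> Suc n \<Longrightarrow> \<psi> i 0 = x0 i"
      using triangular_system_solution[where \<eta> = \<eta> and m = n and N = "Suc n" and c = x0,
          OF eta0 eta_supp eta_cont x0_nonneg] by blast
    have "tame (moment Lsq x0) (\<lambda>i. \<psi> i t)" if t: "0 \<le> t" for t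
    proof -
      have "moment Lsq (\<lambda>i. \<psi> i t) = (\<Sum>i = 1..Suc n. (\<Lambda> i)\<^sup>2 * \<psi> i t)"
        by (rule moment_finite_support(2)) (rule supp)
      also have "\<dots> \<le> (\<Sum>i = 1..Suc n. (\<Lambda> i)\<^sup>2 * \<psi> i 0)"
        by (rule square_moment_nonincreasing[OF ev psi0 supp eta0 fin_norm_finite_support[OF eta_supp] t])
      also have "\<dots> = (\<Sum>i = 1..Suc n. (\<Lambda> i)\<^sup>2 * x0 i)"
        using init by (intro sum.cong) auto
      also have "\<dots> \<le> moment Lsq x0" by (rule tame_partial_sums(2)[OF x0])
      finally have "moment Lsq (\<lambda>i. \<psi> i t) \<le> moment Lsq x0" .
      moreover have "finite_moment Lsq (\<lambda>i. \<psi> i t)"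
        by (rule moment_finite_support(1)) (rule supp)
      ultimately show ?thesis using psi0 t by (simp add: tame_def)
    qed
    then have "approximant x0 (Suc n) \<psi>"
      using supp init evolves_continuous[OF ev] by (auto simp: approximant_def)
    with ev show "\<exists>\<psi>. approximant x0 (Suc n) \<psi> \<and> evolves \<eta> \<psi>" by blast
  qed
  then show thesis using that by blast
qed

lemma approximants_converge:
  assumes x0: "tame (moment Lsq x0) x0"
    and X: "\<And>n. approximant x0 n (X n)" and ev: "\<And>n. evolves (X n) (X (Suc n))"
    and C: "0 < C" "moment Lsq x0 \<le> C"
  obtains \<psi> R where "\<And>t. 0 \<le> t \<Longrightarrow> tame (moment Lsq x0) (\<lambda>i. \<psi> i t)"
    "\<And>i. 1 \<le> i \<Longrightarrow> \<psi> i 0 = x0 i" "R \<longlonglongrightarrow> 0" "\<And>i t. 1 \<le> i \<Longrightarrow> 0 \<le> t \<Longrightarrow> (\<lambda>n. X n i t) \<longlonglongrightarrow> \<psi> i t"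
    "\<And>n t. 0 \<le> t \<Longrightarrow> wnorm (\<lambda>i. X n i t - \<psi> i t) \<le> R n * exp (4 * C * t)"
proof -
  have tameM: "tame (moment Lsq x0) (\<lambda>i. X n i t)" if "0 \<le> t" for n t
    using X[of n] that by (auto simp: approximant_def)
  then have tameC: "tame C (\<lambda>i. X n i t)" if "0 \<le> t" for n t using C(2) that by (blast intro: tame_mono)
  note fin = tame_fin_norm(1)[OF tameC]
  have fin0: "fin_norm x0" by (rule tame_fin_norm(1)[OF x0])
  have x0_nonneg: "0 \<le> x0 i" if "1 \<le> i" for i using x0 that by (auto simp: tame_def)
  \<comment> \<open>The shift by 2 arises because the step from index \<open>n\<close> to
    \<open>Suc n\<close> compares the data of iterates \<open>n + 2\<close> and
    \<open>n + 1\<close>, which differ only at size \<open>n + 2\<close>.\<close>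
  define d where "d n = \<Lambda> (n + 2) * x0 (n + 2)" for n
  have init: "wnorm (\<lambda>i. X (n + 2) i 0 - X (n + 1) i 0) = d n" for n
  proof -
    have "X (n + 2) i 0 = X (n + 1) i 0" if "1 \<le> i" "i \<noteq> n + 2" for i
      using X[of "n + 1"] X[of "n + 2"] that by (cases "i \<le> n + 1") (auto simp: approximant_def)
    then have "wnorm (\<lambda>i. X (n + 2) i 0 - X (n + 1) i 0) = (\<Sum>\<^sub>\<infinity>i\<in>{n + 2}. \<Lambda> i * \<bar>X (n + 2) i 0 - X (n + 1) i 0\<bar>)"
      unfolding wnorm_def by (intro infsum_cong_neutral) auto
    also have "\<dots> = d n"
      using X[of "n + 1"] X[of "n + 2"] x0_nonneg[of "n + 2"] by (simp add: approximant_def d_def)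
    finally show ?thesis .
  qed
  have d_nonneg: "0 \<le> d n" for n unfolding d_def using Lam_nonneg x0_nonneg by simp
  have d_bound: "(\<Sum>m<n. d m) \<le> wnorm x0" for n
  proof -
    have "(\<Sum>m<n. d m) = (\<Sum>i\<in>(\<lambda>m. m + 2) ` {..<n}. \<Lambda> i * \<bar>x0 i\<bar>)"
      using x0_nonneg by (subst sum.reindex) (auto simp: d_def inj_on_def)
    also have "\<dots> \<le> wnorm x0"
      unfolding wnorm_def using fin0 Lam_nonneg by (intro finite_sum_le_infsum) (auto simp: fin_norm_def)
    finally show ?thesis .
  qed
  \<comment> \<open>The start value \<open>2 * C\<close> is the crude bound for the difference of
    two tame sequences.\<close>
  define S where "S = rec_nat (2 * C) (\<lambda>n s. d n + s / 2)"
  have S_simps: "S 0 = 2 * C" "S (Suc n) = d n + S n / 2" for n by (simp_all add: S_def)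
  have S_nonneg: "0 \<le> S n" and S_sum: "summable S" for n
    using half_recursion_summable[of S d "wnorm x0", OF S_simps(2) _ d_nonneg d_bound] C(1)
    by (auto simp: S_simps(1))
  have step: "wnorm (\<lambda>i. X (Suc n) i t - X n i t) \<le> S n * exp (4 * C * t)" if "0 \<le> t" for n t
    using that
  proof (induction n arbitrary: t)
    case 0
    have "wnorm (\<lambda>i. X (Suc 0) i t - X 0 i t) \<le> C + C"
      using wnorm_diff_le[OF fin fin, OF 0 0, of "Suc 0" 0] tame_fin_norm(2)[OF tameC, OF 0, of 0]
        tame_fin_norm(2)[OF tameC, OF 0, of "Suc 0"] by linarith
    also have "\<dots> \<le> 2 * C * exp (4 * C * t)" using C(1) 0 by simp
    finally show ?case by (simp add: S_simps)
  next
    case (Suc n)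
    have "wnorm (\<lambda>i. X (Suc (Suc n)) i t - X (Suc n) i t) \<le>
        wnorm (\<lambda>i. X (Suc (Suc n)) i 0 - X (Suc n) i 0) + S n / 2 * exp (4 * C * t)"
      by (rule stability[OF tameC tameC tameC tameC ev ev C(1) S_nonneg Suc.IH Suc.prems])
    also have "\<dots> = d n + S n / 2 * exp (4 * C * t)" using init[of n] by simp
    also have "\<dots> \<le> d n * exp (4 * C * t) + S n / 2 * exp (4 * C * t)"
      using d_nonneg[of n] C(1) Suc.prems by (simp add: mult_le_cancel_left1)
    also have "\<dots> = S (Suc n) * exp (4 * C * t)" by (simp add: S_simps algebra_simps)
    finally show ?case .
  qed
  have tele: "wnorm (\<lambda>i. X (n + p) i t - X n i t) \<le> ((\<Sum>m<n + p. S m) - (\<Sum>m<n. S m)) * exp (4 * C * t)"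
    if t: "0 \<le> t" for n p t
  proof (induction p)
    case 0
    then show ?case by (simp add: wnorm_def)
  next
    case (Suc p)
    have "wnorm (\<lambda>i. X (n + Suc p) i t - X n i t) \<le>
        wnorm (\<lambda>i. X (n + Suc p) i t - X (n + p) i t) + wnorm (\<lambda>i. X (n + p) i t - X n i t)"
      by (rule wnorm_triangle[OF fin fin fin, OF t t t])
    also have "\<dots> \<le> S (n + p) * exp (4 * C * t) + ((\<Sum>m<n + p. S m) - (\<Sum>m<n. S m)) * exp (4 * C * t)"
      using step[OF t, of "n + p"] Suc by simp
    also have "\<dots> = ((\<Sum>m<n + Suc p. S m) - (\<Sum>m<n. S m)) * exp (4 * C * t)" by (simp add: algebra_simps)
    finally show ?case .
  qed
  define R where "R n = suminf S - (\<Sum>m<n. S m)" for n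
  have teleR: "wnorm (\<lambda>i. X (n + p) i t - X n i t) \<le> R n * exp (4 * C * t)" if t: "0 \<le> t" for n p t
  proof -
    have "(\<Sum>m<n + p. S m) - (\<Sum>m<n. S m) \<le> R n"
      unfolding R_def using sum_le_suminf[OF S_sum, of "{..<n + p}"] S_nonneg by simp
    then show ?thesis using tele[OF t, of n p] by (meson exp_ge_zero mult_right_mono order_trans)
  qed
  have R: "R \<longlonglongrightarrow> 0"
    unfolding R_def[abs_def] using tendsto_diff[OF tendsto_const summable_LIMSEQ[OF S_sum], of "suminf S"] by simp
  define \<psi> where "\<psi> i t = lim (\<lambda>n. X n i t)" for i t
  have lim: "(\<lambda>n. X n i t) \<longlonglongrightarrow> \<psi> i t" if i: "1 \<le> i" and t: "0 \<le> t" for i t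
  proof -
    have "summable (\<lambda>n. X (Suc n) i t - X n i t)"
    proof (rule summable_comparison_test')
      show "summable (\<lambda>n. S n * exp (4 * C * t))" using S_sum by (rule summable_mult2)
      show "norm (X (Suc n) i t - X n i t) \<le> S n * exp (4 * C * t)" for n
        using component_le_wnorm[OF fin_norm_diff[OF fin fin, OF t t] i, of "Suc n" n] step[OF t, of n] by simp
    qed
    then have "(\<lambda>n. \<Sum>m<n. X (Suc m) i t - X m i t) \<longlonglongrightarrow> (\<Sum>m. X (Suc m) i t - X m i t)"
      by (rule summable_LIMSEQ)
    from tendsto_add[OF this tendsto_const[of "X 0 i t"]] have "convergent (\<lambda>n. X n i t)"
      unfolding sum_lessThan_telescope[of "\<lambda>m. X m i t"] by (auto intro: convergentI)
    then show ?thesis unfolding \<psi>_def by (simp add: convergent_LIMSEQ_iff)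
  qed
  have tame_psi: "tame (moment Lsq x0) (\<lambda>i. \<psi> i t)" if t: "0 \<le> t" for t
  proof (rule tameI_partial_sums)
    show "0 \<le> \<psi> i t" if "1 \<le> i" for i
      by (rule LIMSEQ_le_const[OF lim[OF that t]]) (use tameM[OF t] that in \<open>auto simp: tame_def\<close>)
    show "(\<Sum>i = 1..n. (\<Lambda> i)\<^sup>2 * \<psi> i t) \<le> moment Lsq x0" for n
    proof (rule LIMSEQ_le_const2)
      show "(\<lambda>m. \<Sum>i = 1..n. (\<Lambda> i)\<^sup>2 * X m i t) \<longlonglongrightarrow> (\<Sum>i = 1..n. (\<Lambda> i)\<^sup>2 * \<psi> i t)"
        by (intro tendsto_sum tendsto_mult tendsto_const lim t) auto
    qed (use tame_partial_sums(2)[OF tameM[OF t]] in auto)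
  qed
  show thesis
  proof (rule that[of \<psi> R])
    show "\<psi> i 0 = x0 i" if "1 \<le> i" for i
    proof (rule LIMSEQ_unique[OF lim[OF that order_refl]])
      show "(\<lambda>n. X n i 0) \<longlonglongrightarrow> x0 i"
        by (rule tendsto_eventually, rule eventually_sequentiallyI[of i])
          (use X that in \<open>auto simp: approximant_def\<close>)
    qed
    \<comment> \<open>The limit is taken on partial sums: first \<open>p\<close> tends to infinity
      with \<open>k\<close> sizes fixed, then \<open>k\<close> does.\<close>
    show "wnorm (\<lambda>i. X n i t - \<psi> i t) \<le> R n * exp (4 * C * t)" if t: "0 \<le> t" for n t
    proof (rule LIMSEQ_le_const2)
      have fin_psi: "fin_norm (\<lambda>i. X n i t - \<psi> i t)"
        by (rule fin_norm_diff[OF fin[OF t] tame_fin_norm(1)[OF tame_psi[OF t]]])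
      then show "(\<lambda>k. \<Sum>i = 1..k. \<Lambda> i * \<bar>X n i t - \<psi> i t\<bar>) \<longlonglongrightarrow> wnorm (\<lambda>i. X n i t - \<psi> i t)"
        unfolding wnorm_def
        by (intro has_sum_imp_partial_sums_tendsto has_sum_infsum) (auto simp: fin_norm_def)
      have "(\<Sum>i = 1..k. \<Lambda> i * \<bar>X n i t - \<psi> i t\<bar>) \<le> R n * exp (4 * C * t)" for k
      proof (rule LIMSEQ_le_const2)
        show "(\<lambda>p. \<Sum>i = 1..k. \<Lambda> i * \<bar>X n i t - X (p + n) i t\<bar>) \<longlonglongrightarrow> (\<Sum>i = 1..k. \<Lambda> i * \<bar>X n i t - \<psi> i t\<bar>)"
          by (intro tendsto_sum tendsto_mult tendsto_const tendsto_rabs tendsto_diff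
              LIMSEQ_ignore_initial_segment lim t) auto
        have "(\<Sum>i = 1..k. \<Lambda> i * \<bar>X n i t - X (p + n) i t\<bar>) \<le> R n * exp (4 * C * t)" for p
          using partial_sum_le_wnorm[where n = k, OF fin_norm_diff[OF fin fin, OF t t, of n "p + n"]]
            teleR[OF t, of n p] wnorm_minus_commute[of "\<lambda>i. X n i t" "\<lambda>i. X (n + p) i t"]
          unfolding add.commute[of p n]
          by linarith
        then show "\<exists>N. \<forall>p\<ge>N. (\<Sum>i = 1..k. \<Lambda> i * \<bar>X n i t - X (p + n) i t\<bar>) \<le> R n * exp (4 * C * t)" by blast
      qed
      then show "\<exists>N. \<forall>k\<ge>N. (\<Sum>i = 1..k. \<Lambda> i * \<bar>X n i t - \<psi> i t\<bar>) \<le> R n * exp (4 * C * t)" by blast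
    qed
  qed (use tame_psi R lim in auto)
qed

lemma pairsum_uniform_limit:
  assumes c: "coeff_bound K c" and K: "0 \<le> K"
    and X: "\<And>n t. 0 \<le> t \<Longrightarrow> tame C (\<lambda>i. X n i t)" and psi: "\<And>t. 0 \<le> t \<Longrightarrow> tame C (\<lambda>i. \<psi> i t)"
    and R: "R \<longlonglongrightarrow> 0" and C: "0 < C"
    and conv: "\<And>n t. 0 \<le> t \<Longrightarrow> wnorm (\<lambda>i. X n i t - \<psi> i t) \<le> R n * exp (4 * C * t)"
  shows "uniform_limit {0..T} (\<lambda>n t. pairsum c (\<lambda>i. X (Suc n) i t) (\<lambda>i. X n i t))
    (\<lambda>t. pairsum c (\<lambda>i. \<psi> i t) (\<lambda>i. \<psi> i t)) sequentially"
proof (rule uniform_limitI)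
  fix e :: real assume e: "0 < e"
  let ?B = "\<lambda>n. K * C * exp (4 * C * T) * (R (Suc n) + R n)"
  have "?B \<longlonglongrightarrow> K * C * exp (4 * C * T) * (0 + 0)"
    by (intro tendsto_intros R LIMSEQ_Suc[OF R])
  then have "\<forall>\<^sub>F n in sequentially. ?B n < e" using e by (auto dest: order_tendstoD(2))
  then show "\<forall>\<^sub>F n in sequentially. \<forall>t\<in>{0..T}. dist (pairsum c (\<lambda>i. X (Suc n) i t) (\<lambda>i. X n i t))
      (pairsum c (\<lambda>i. \<psi> i t) (\<lambda>i. \<psi> i t)) < e"
  proof (rule eventually_mono, intro ballI)
    fix n t assume n: "?B n < e" and "t \<in> {0..T}"
    then have t: "0 \<le> t" "t \<le> T" by auto
    have R0: "0 \<le> R m" for m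
    proof -
      have "0 \<le> R m * exp (4 * C * t)" using conv[OF t(1), of m] wnorm_nonneg order_trans by blast
      then show ?thesis by (simp add: zero_le_mult_iff)
    qed
    have bound: "wnorm (\<lambda>i. X m i t - \<psi> i t) \<le> R m * exp (4 * C * T)" for m
    proof -
      have "R m * exp (4 * C * t) \<le> R m * exp (4 * C * T)" using C t R0 by (intro mult_left_mono) auto
      then show ?thesis using conv[OF t(1), of m] by linarith
    qed
    note fin = tame_fin_norm(1)[OF X[OF t(1)]] tame_fin_norm(1)[OF psi[OF t(1)]]
    have "\<bar>pairsum c (\<lambda>i. X (Suc n) i t) (\<lambda>i. X n i t) - pairsum c (\<lambda>i. \<psi> i t) (\<lambda>i. \<psi> i t)\<bar> \<le>
        K * wnorm (\<lambda>i. X (Suc n) i t - \<psi> i t) * wnorm (\<lambda>i. X n i t)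
        + K * wnorm (\<lambda>i. \<psi> i t) * wnorm (\<lambda>i. X n i t - \<psi> i t)"
      by (rule pairsum_diff_bound[OF c fin fin])
    also have "\<dots> \<le> K * (R (Suc n) * exp (4 * C * T)) * C + K * C * (R n * exp (4 * C * T))"
      using K C wnorm_nonneg bound[of n] bound[of "Suc n"] R0
        tame_fin_norm(2)[OF X[OF t(1)], of n] tame_fin_norm(2)[OF psi[OF t(1)]]
      by (intro add_mono mult_mono mult_nonneg_nonneg) auto
    also have "\<dots> = ?B n" by (simp add: algebra_simps)
    finally show "dist (pairsum c (\<lambda>i. X (Suc n) i t) (\<lambda>i. X n i t)) (pairsum c (\<lambda>i. \<psi> i t) (\<lambda>i. \<psi> i t)) < e"
      using n by (simp add: dist_real_def)
  qed
qed

lemma approximant_pairsum_continuous: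
  assumes "approximant x0 n \<psi>" "approximant x0 m \<eta>"
  shows "continuous_on {0..T} (\<lambda>t. pairsum c (\<lambda>i. \<psi> i t) (\<lambda>i. \<eta> i t))"
proof -
  have cont: "continuous_on {0..T} (\<psi> i)" "continuous_on {0..T} (\<eta> i)" if "1 \<le> i" for i
    using assms that by (auto simp: approximant_def elim!: continuous_on_subset[of "{0..}"])
  have "pairsum c (\<lambda>i. \<psi> i t) (\<lambda>i. \<eta> i t) = (\<Sum>j = 1..n. \<Sum>k = 1..m. c j k * \<psi> j t * \<eta> k t)" for t
    using assms by (intro pairsum_finite_support) (auto simp: approximant_def)
  then show ?thesis by (auto intro!: continuous_intros cont)
qed

text \<open>The limit is taken in the integrated equation: the rates converge uniformly on bounded
  intervals, hence so do their integrals, and continuity of the limit rate allows differentiating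
  back.\<close>

lemma solution_exists:
  assumes x0: "tame (moment Lsq x0) x0"
  obtains \<psi> where "\<And>t. 0 \<le> t \<Longrightarrow> tame (moment Lsq x0) (\<lambda>i. \<psi> i t)" "evolves \<psi> \<psi>"
    "\<And>i. 1 \<le> i \<Longrightarrow> \<psi> i 0 = x0 i"
    "\<And>i. 1 \<le> i \<Longrightarrow> continuous_on {0..} (\<lambda>t. pairsum (gain_coeff i) (\<lambda>l. \<psi> l t) (\<lambda>l. \<psi> l t))"
    "\<And>i. 1 \<le> i \<Longrightarrow> continuous_on {0..} (\<lambda>t. pairsum (loss_coeff i) (\<lambda>l. \<psi> l t) (\<lambda>l. \<psi> l t))"
proof -
  \<comment> \<open>Adding 1 secures strict positivity even for the zero datum; the sharp bound
    \<open>moment Lsq x0\<close> is carried along separately.\<close>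
  define C where "C = moment Lsq x0 + 1"
  have C: "0 < C" "moment Lsq x0 \<le> C"
    using tame_partial_sums(2)[OF x0, of 0] by (auto simp: C_def)
  obtain X where X: "\<And>n. approximant x0 n (X n)" and evX: "\<And>n. evolves (X n) (X (Suc n))"
    using approximants_exist[OF x0] by blast
  obtain \<psi> R where tame: "\<And>t. 0 \<le> t \<Longrightarrow> tame (moment Lsq x0) (\<lambda>i. \<psi> i t)"
    and init: "\<And>i. 1 \<le> i \<Longrightarrow> \<psi> i 0 = x0 i" and R: "R \<longlonglongrightarrow> 0"
    and lim: "\<And>i t. 1 \<le> i \<Longrightarrow> 0 \<le> t \<Longrightarrow> (\<lambda>n. X n i t) \<longlonglongrightarrow> \<psi> i t"
    and conv: "\<And>n t. 0 \<le> t \<Longrightarrow> wnorm (\<lambda>i. X n i t - \<psi> i t) \<le> R n * exp (4 * C * t)"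
    using approximants_converge[OF x0 X evX C] by blast
  have tameX: "tame C (\<lambda>i. X n i t)" if "0 \<le> t" for n t
    using X[of n] that C(2) by (auto simp: approximant_def intro: tame_mono)
  have tameC: "tame C (\<lambda>i. \<psi> i t)" if "0 \<le> t" for t using tame[OF that] C(2) by (rule tame_mono)
  have ul: "uniform_limit {0..T} (\<lambda>n t. pairsum c (\<lambda>i. X (Suc n) i t) (\<lambda>i. X n i t))
      (\<lambda>t. pairsum c (\<lambda>i. \<psi> i t) (\<lambda>i. \<psi> i t)) sequentially" if "coeff_bound K c" "0 \<le> K" for c K T
    by (rule pairsum_uniform_limit[OF that tameX tameC R C(1) conv])
  have cont: "continuous_on {0..} (\<lambda>t. pairsum c (\<lambda>i. \<psi> i t) (\<lambda>i. \<psi> i t))"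
    if "coeff_bound K c" "0 \<le> K" for c K
    by (intro continuous_on_halfline uniform_limit_theorem[OF _ ul[OF that]] always_eventually allI
        approximant_pairsum_continuous[OF X X]) simp
  have cont_gain: "continuous_on {0..} (\<lambda>t. pairsum (gain_coeff i) (\<lambda>l. \<psi> l t) (\<lambda>l. \<psi> l t))" if "1 \<le> i" for i
    using coeff_bound_gain[OF that] alpha_nonneg by (rule cont)
  have cont_loss: "continuous_on {0..} (\<lambda>t. pairsum (loss_coeff i) (\<lambda>l. \<psi> l t) (\<lambda>l. \<psi> l t))" for i
    using coeff_bound_loss zero_le_one by (rule cont)
  have ev: "evolves \<psi> \<psi>"
    unfolding evolves_def
  proof (intro allI impI)
    fix i :: nat and t :: real assume i: "1 \<le> i" and t: "0 \<le> t"
    define f where "f s = rate i (\<lambda>l. \<psi> l s) (\<lambda>l. \<psi> l s)" for s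
    define fX where "fX n s = rate i (\<lambda>l. X (Suc n) l s) (\<lambda>l. X n l s)" for n s
    have f: "continuous_on {0..} f"
      unfolding f_def[abs_def] rate_def by (intro continuous_on_diff cont_gain cont_loss i)
    have fX: "continuous_on {0..T} (fX n)" for n T
      unfolding fX_def[abs_def] rate_def
      by (intro continuous_on_diff approximant_pairsum_continuous[OF X X])
    have ulf: "uniform_limit {0..T} fX f sequentially" for T
      unfolding f_def[abs_def] fX_def[abs_def] rate_def
      by (intro uniform_limit_minus ul[OF coeff_bound_gain[OF i] alpha_nonneg]
          ul[OF coeff_bound_loss zero_le_one])
    have int: "\<psi> i s = x0 i + integral {0..s} f" if s: "0 \<le> s" for s
    proof -
      obtain I J where I: "\<And>n. (fX n has_integral I n) {0..s}" and J: "(f has_integral J) {0..s}"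
        and IJ: "I \<longlonglongrightarrow> J"
        using uniform_limit_integral[OF ulf[of s] fX] by auto
      have "(fX n has_integral (X (Suc n) i s - X (Suc n) i 0)) {0..s}" for n
        using s evX[of n] i
        by (intro fundamental_theorem_of_calculus)
          (auto simp: fX_def evolves_def simp flip: has_real_derivative_iff_has_vector_derivative
            intro!: DERIV_subset[of _ _ _ "{0..}" "{0..s}"])
      then have "I = (\<lambda>n. X (Suc n) i s - X (Suc n) i 0)"
        using I by (auto simp: fun_eq_iff intro: has_integral_unique)
      moreover have "(\<lambda>n. X (Suc n) i s - X (Suc n) i 0) \<longlonglongrightarrow> \<psi> i s - \<psi> i 0"
        using i s by (intro tendsto_diff LIMSEQ_Suc[OF lim]) auto
      ultimately have "J = \<psi> i s - \<psi> i 0" using IJ LIMSEQ_unique by blast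
      then show ?thesis using integral_unique[OF J] init[OF i] by simp
    qed
    have "((\<lambda>s. x0 i + integral {0..s} f) has_real_derivative 0 + f t) (at t within {0..})"
      by (intro DERIV_add DERIV_const integral_has_real_derivative_halfline f t)
    then have "(\<psi> i has_real_derivative f t) (at t within {0..})"
      unfolding add_0_left
      by (rule has_field_derivative_transform_within[where d = 1]) (use t int in auto)
    then show "(\<psi> i has_real_derivative rate i (\<lambda>l. \<psi> l t) (\<lambda>l. \<psi> l t)) (at t within {0..})"
      by (simp add: f_def)
  qed
  show thesis by (rule that[OF tame ev init cont_gain cont_loss])
qed

subsection \<open>Classical solutions\<close>

text \<open>Absolute summability over pairs permits iterated summation, and the rows
  \<open>j \<le> i\<close> vanish.\<close>

lemma gain_eq_pairsum:
  assumes i: "1 \<le> i" and u: "fin_norm u"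
  shows "gain \<Gamma> \<Phi> u i = pairsum (gain_coeff i) u u" "gain_converges \<Gamma> \<Phi> u i"
proof -
  let ?f = "\<lambda>j k. gain_coeff i j k * u j * u k"
  have f: "(\<lambda>(j, k). ?f j k) summable_on {1..} \<times> {1..}"
    using pairsum_has_sum(1)[OF coeff_bound_gain[OF i] u u] by (rule has_sum_imp_summable)
  have eq: "(\<Sum>\<^sub>\<infinity>k\<in>{1..}. ?f j k) = (\<Sum>\<^sub>\<infinity>k\<in>{1..}. \<Phi> i j k * \<Gamma> j k * u j * u k)" if "j \<in> {i + 1..}" for j
    using that by (simp add: gain_coeff_def)
  have "pairsum (gain_coeff i) u u = (\<Sum>\<^sub>\<infinity>j\<in>{1..}. \<Sum>\<^sub>\<infinity>k\<in>{1..}. ?f j k)"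
    unfolding pairsum_def by (rule infsum_Sigma'_banach[OF f, symmetric])
  also have "\<dots> = (\<Sum>\<^sub>\<infinity>j\<in>{i + 1..}. \<Sum>\<^sub>\<infinity>k\<in>{1..}. ?f j k)"
    by (intro infsum_cong_neutral) (auto simp: gain_coeff_def)
  also have "\<dots> = gain \<Gamma> \<Phi> u i"
    unfolding gain_def by (intro infsum_cong eq)
  finally show "gain \<Gamma> \<Phi> u i = pairsum (gain_coeff i) u u" ..
  have "(\<lambda>k. \<Phi> i j k * \<Gamma> j k * u j * u k) summable_on {1..}" if "i + 1 \<le> j" for j
    using summable_on_SigmaD1[OF f, of j] that by (simp add: gain_coeff_def)
  moreover have "(\<lambda>j. \<Sum>\<^sub>\<infinity>k\<in>{1..}. ?f j k) summable_on {i + 1..}"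
    by (rule summable_on_subset_banach[OF summable_on_Sigma_banach[OF f]]) auto
  moreover have "(\<lambda>j. \<Sum>\<^sub>\<infinity>k\<in>{1..}. ?f j k) summable_on {i + 1..} \<longleftrightarrow>
      (\<lambda>j. \<Sum>\<^sub>\<infinity>k\<in>{1..}. \<Phi> i j k * \<Gamma> j k * u j * u k) summable_on {i + 1..}"
    by (intro summable_on_cong eq)
  ultimately show "gain_converges \<Gamma> \<Phi> u i"
    unfolding gain_converges_def by blast
qed

text \<open>Only the row \<open>j = i\<close> survives; for \<open>i = 1\<close> it vanishes too, in
  agreement with the factor 0 in \<open>loss\<close>.\<close>

lemma loss_eq_pairsum:
  assumes i: "1 \<le> i" and u: "fin_norm u"
  shows "loss \<Gamma> u i = pairsum (loss_coeff i) u u" "loss_converges \<Gamma> u i"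
proof -
  let ?f = "\<lambda>j k. loss_coeff i j k * u j * u k"
  have f: "(\<lambda>(j, k). ?f j k) summable_on {1..} \<times> {1..}"
    using pairsum_has_sum(1)[OF coeff_bound_loss u u] by (rule has_sum_imp_summable)
  have "pairsum (loss_coeff i) u u = (\<Sum>\<^sub>\<infinity>j\<in>{1..}. \<Sum>\<^sub>\<infinity>k\<in>{1..}. ?f j k)"
    unfolding pairsum_def by (rule infsum_Sigma'_banach[OF f, symmetric])
  also have "\<dots> = (\<Sum>\<^sub>\<infinity>j\<in>{i}. \<Sum>\<^sub>\<infinity>k\<in>{1..}. ?f j k)"
    using i by (intro infsum_cong_neutral) (auto simp: loss_coeff_def)
  also have "\<dots> = loss \<Gamma> u i"
    by (simp add: loss_def loss_coeff_def)
  finally show "loss \<Gamma> u i = pairsum (loss_coeff i) u u" ..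
  show "loss_converges \<Gamma> u i"
    using summable_on_SigmaD1[OF f, of i] i
    by (cases "i = 1") (auto simp: loss_converges_def loss_coeff_def)
qed

lemma evolves_imp_classical_solution:
  assumes tame: "\<And>t. 0 \<le> t \<Longrightarrow> tame C (\<lambda>i. \<psi> i t)"
    and cont: "\<And>i. 1 \<le> i \<Longrightarrow> continuous_on {0..} (\<lambda>t. pairsum (gain_coeff i) (\<lambda>l. \<psi> l t) (\<lambda>l. \<psi> l t))"
      "\<And>i. 1 \<le> i \<Longrightarrow> continuous_on {0..} (\<lambda>t. pairsum (loss_coeff i) (\<lambda>l. \<psi> l t) (\<lambda>l. \<psi> l t))"
    and ev: "evolves \<psi> \<psi>" and init: "\<And>i. 1 \<le> i \<Longrightarrow> \<psi> i 0 = x0 i"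
  shows "classical_solution \<Gamma> \<Phi> x0 \<psi>"
proof -
  have fin: "fin_norm (\<lambda>i. \<psi> i t)" if "0 \<le> t" for t by (rule tame_fin_norm(1)[OF tame[OF that]])
  note gl = gain_eq_pairsum[OF _ fin] loss_eq_pairsum[OF _ fin]
  have nonneg: "0 \<le> \<psi> i t" if "1 \<le> i" "0 \<le> t" for i t using tame[OF that(2)] that(1) by (simp add: tame_def)
  have "(\<lambda>i. \<psi> i t) \<in> Y1_plus" if t: "0 \<le> t" for t
  proof -
    have "(\<lambda>i. real i * \<bar>\<psi> i t\<bar>) summable_on {1..}"
      by (rule summable_on_comparison_test[where f = "\<lambda>i. \<Lambda> i * \<bar>\<psi> i t\<bar>"])
        (use fin[OF t] Lam_ge in \<open>auto simp: fin_norm_def intro: mult_right_mono\<close>)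
    then show ?thesis using nonneg t by (simp add: Y1_plus_def Y1_def)
  qed
  moreover have deriv: "(\<psi> i has_real_derivative gain \<Gamma> \<Phi> (\<lambda>l. \<psi> l t) i - loss \<Gamma> (\<lambda>l. \<psi> l t) i)
      (at t within {0..})" if "1 \<le> i" "0 \<le> t" for i t
    using ev that by (simp add: evolves_def rate_def gl)
  moreover have cg: "continuous_on {0..} (\<lambda>t. gain \<Gamma> \<Phi> (\<lambda>l. \<psi> l t) i)"
    and cl: "continuous_on {0..} (\<lambda>t. loss \<Gamma> (\<lambda>l. \<psi> l t) i)" if "1 \<le> i" for i
    using continuous_on_eq[OF cont(1)[OF that]] continuous_on_eq[OF cont(2)[OF that]] that
    by (simp_all add: gl)
  moreover have "C1_halfline (\<psi> i)" if i: "1 \<le> i" for i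
    unfolding C1_halfline_def
  proof (intro conjI allI impI)
    show "\<psi> i differentiable (at t within {0..})" if "0 \<le> t" for t
      using deriv[OF i that] by (auto simp: has_field_derivative_def differentiable_def)
    have "hderiv (\<psi> i) t = gain \<Gamma> \<Phi> (\<lambda>l. \<psi> l t) i - loss \<Gamma> (\<lambda>l. \<psi> l t) i" if "0 \<le> t" for t
      unfolding hderiv_def using deriv[OF i that] at_within_halfline_neq_bot[OF that]
      by (intro vector_derivative_within) (auto simp: has_real_derivative_iff_has_vector_derivative)
    then show "continuous_on {0..} (hderiv (\<psi> i))"
      using continuous_on_eq[OF continuous_on_diff[OF cg[OF i] cl[OF i]]] by simp
  qed
  ultimately show ?thesis
    unfolding classical_solution_def using nonneg init gl(2,4) by simp
qed

text \<open>The moment bound gives finite weighted norm at each time, which identifies the iterated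
  gain and loss series with pair sums.\<close>

lemma classical_solution_evolves:
  assumes sol: "classical_solution \<Gamma> \<Phi> x0 \<psi>"
    and moment: "\<And>t. 0 \<le> t \<Longrightarrow> finite_moment Lsq (\<lambda>i. \<psi> i t) \<and> moment Lsq (\<lambda>i. \<psi> i t) \<le> C"
  shows "\<And>t. 0 \<le> t \<Longrightarrow> tame C (\<lambda>i. \<psi> i t)" "evolves \<psi> \<psi>" "\<And>i. 1 \<le> i \<Longrightarrow> \<psi> i 0 = x0 i"
proof -
  show tame: "tame C (\<lambda>i. \<psi> i t)" if "0 \<le> t" for t
    using sol moment[OF that] that by (auto simp: classical_solution_def tame_def)
  have fin: "fin_norm (\<lambda>i. \<psi> i t)" if "0 \<le> t" for t by (rule tame_fin_norm(1)[OF tame[OF that]])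
  show "evolves \<psi> \<psi>"
    using sol by (simp add: classical_solution_def evolves_def rate_def
        gain_eq_pairsum(1)[OF _ fin] loss_eq_pairsum(1)[OF _ fin])
  show "\<psi> i 0 = x0 i" if "1 \<le> i" for i using sol that by (simp add: classical_solution_def)
qed

text \<open>Each solution is its own background, so every application of stability halves the bound
  on their difference; starting from \<open>2 * C\<close>, it tends to 0.\<close>

lemma evolves_unique:
  assumes psi: "\<And>t. 0 \<le> t \<Longrightarrow> tame C (\<lambda>i. \<psi> i t)" "evolves \<psi> \<psi>"
    and eta: "\<And>t. 0 \<le> t \<Longrightarrow> tame C (\<lambda>i. \<eta> i t)" "evolves \<eta> \<eta>"
    and init: "\<And>i. 1 \<le> i \<Longrightarrow> \<psi> i 0 = \<eta> i 0" and C: "0 < C"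
    and i: "1 \<le> i" and t: "0 \<le> t"
  shows "\<psi> i t = \<eta> i t"
proof -
  have init0: "wnorm (\<lambda>i. \<psi> i 0 - \<eta> i 0) = 0"
    unfolding wnorm_def using init by (intro infsum_0) simp
  have "wnorm (\<lambda>i. \<psi> i t - \<eta> i t) \<le> (2 * C / 2 ^ m) * exp (4 * C * t)" if "0 \<le> t" for m t
    using that
  proof (induction m arbitrary: t)
    case 0
    have "wnorm (\<lambda>i. \<psi> i t - \<eta> i t) \<le> C + C"
      using wnorm_diff_le[OF tame_fin_norm(1)[OF psi(1)] tame_fin_norm(1)[OF eta(1)], OF 0 0]
        tame_fin_norm(2)[OF psi(1)[OF 0]] tame_fin_norm(2)[OF eta(1)[OF 0]] by linarith
    also have "\<dots> \<le> 2 * C * exp (4 * C * t)" using C 0 by simp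
    finally show ?case by simp
  next
    case (Suc m)
    have "wnorm (\<lambda>i. \<psi> i t - \<eta> i t) \<le>
        wnorm (\<lambda>i. \<psi> i 0 - \<eta> i 0) + (2 * C / 2 ^ m) / 2 * exp (4 * C * t)"
      using C by (intro stability[OF psi(1) eta(1) psi(1) eta(1) psi(2) eta(2)] Suc) auto
    then show ?case using init0 by simp
  qed
  moreover have "(\<lambda>m. (2 * C / 2 ^ m) * exp (4 * C * t)) \<longlonglongrightarrow> 0"
    by (intro tendsto_mult_left_zero LIMSEQ_divide_realpow_zero) simp
  ultimately have "wnorm (\<lambda>i. \<psi> i t - \<eta> i t) \<le> 0"
    using t by (intro LIMSEQ_le_const) auto
  then show ?thesis
    using component_le_wnorm[OF fin_norm_diff[OF tame_fin_norm(1)[OF psi(1)] tame_fin_norm(1)[OF eta(1)], OF t t] i]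
    by simp
qed

end

theorem theorem1p6:
  fixes \<Lambda> :: "nat \<Rightarrow> real"
    and \<Gamma> :: "nat \<Rightarrow> nat \<Rightarrow> real"
    and \<Phi> :: "nat \<Rightarrow> nat \<Rightarrow> nat \<Rightarrow> real"
    and \<alpha>\<^sub>0 :: real
    and \<psi>in :: "nat \<Rightarrow> real"
    and G\<^sub>0 :: "real \<Rightarrow> real"
  assumes "\<forall>i\<ge>1. 0 \<le> \<Lambda> i"
    and "1 \<le> \<Lambda> 1"
    and "mono_on {1..} (\<lambda>i. \<Lambda> i / real i)"
    and "\<forall>i\<ge>1. \<forall>j\<ge>1. 0 \<le> \<Gamma> i j \<and> \<Gamma> i j = \<Gamma> j i \<and> \<Gamma> i j \<le> \<Lambda> i * \<Lambda> j"
    and "\<forall>j\<ge>2. \<forall>k\<ge>1. \<forall>i\<in>{1..j-1}. 0 \<le> \<Phi> i j k"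
    and "\<forall>j\<ge>2. \<forall>k\<ge>1. (\<Sum>i=1..j-1. real i * \<Phi> i j k) = real j"
    and "0 \<le> \<alpha>\<^sub>0"
    and "\<forall>j\<ge>2. \<forall>k\<ge>1. \<forall>i\<in>{1..j-1}. \<Phi> i j k \<le> \<alpha>\<^sub>0"
    and "\<psi>in \<in> Y1_plus"
    and "G\<^sub>0 \<in> G1_inf"
    and "finite_moment (\<lambda>i. G\<^sub>0 (real i)) \<psi>in"
    and "finite_moment \<Lambda> \<psi>in"
    and "finite_moment (\<lambda>i. (\<Lambda> i)\<^sup>2) \<psi>in"
  shows "\<exists>\<psi>. (classical_solution \<Gamma> \<Phi> \<psi>in \<psi> \<and>
               (\<forall>t\<ge>0. finite_moment (\<lambda>i. (\<Lambda> i)\<^sup>2) (\<lambda>i. \<psi> i t) \<and>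
                       moment (\<lambda>i. (\<Lambda> i)\<^sup>2) (\<lambda>i. \<psi> i t) \<le> moment (\<lambda>i. (\<Lambda> i)\<^sup>2) \<psi>in)) \<and>
             (\<forall>\<eta>. classical_solution \<Gamma> \<Phi> \<psi>in \<eta> \<and>
                  (\<forall>t\<ge>0. finite_moment (\<lambda>i. (\<Lambda> i)\<^sup>2) (\<lambda>i. \<eta> i t) \<and>
                          moment (\<lambda>i. (\<Lambda> i)\<^sup>2) (\<lambda>i. \<eta> i t) \<le> moment (\<lambda>i. (\<Lambda> i)\<^sup>2) \<psi>in)
                  \<longrightarrow> (\<forall>i\<ge>1. \<forall>t\<ge>0. \<eta> i t = \<psi> i t))"
proof -
  interpret nonlinear_breakage \<Lambda> \<Gamma> \<Phi> \<alpha>\<^sub>0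
    using assms(1-8) by unfold_locales (auto simp: Ball_def)
  have in_tame: "tame (moment Lsq \<psi>in) \<psi>in"
    using assms(9,13) by (simp add: tame_def Y1_plus_def)
  obtain \<psi> where tame: "\<And>t. 0 \<le> t \<Longrightarrow> tame (moment Lsq \<psi>in) (\<lambda>i. \<psi> i t)" and ev: "evolves \<psi> \<psi>"
    and init: "\<And>i. 1 \<le> i \<Longrightarrow> \<psi> i 0 = \<psi>in i"
    and cont: "\<And>i. 1 \<le> i \<Longrightarrow> continuous_on {0..} (\<lambda>t. pairsum (gain_coeff i) (\<lambda>l. \<psi> l t) (\<lambda>l. \<psi> l t))"
      "\<And>i. 1 \<le> i \<Longrightarrow> continuous_on {0..} (\<lambda>t. pairsum (loss_coeff i) (\<lambda>l. \<psi> l t) (\<lambda>l. \<psi> l t))"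
    using solution_exists[OF in_tame] by blast
  have sol: "classical_solution \<Gamma> \<Phi> \<psi>in \<psi>"
    by (rule evolves_imp_classical_solution[OF tame cont ev init])
  have unique: "\<eta> i t = \<psi> i t"
    if sol: "classical_solution \<Gamma> \<Phi> \<psi>in \<eta>"
      and moment: "\<forall>t\<ge>0. finite_moment Lsq (\<lambda>i. \<eta> i t) \<and> moment Lsq (\<lambda>i. \<eta> i t) \<le> moment Lsq \<psi>in"
      and it: "1 \<le> i" "0 \<le> t" for \<eta> i t
  proof -
    define C where "C = moment Lsq \<psi>in + 1"
    have C: "0 < C" "moment Lsq \<psi>in \<le> C" using tame_partial_sums(2)[OF in_tame, of 0] by (auto simp: C_def)
    \<comment> \<open>The moment bound imposed on competing solutions places them in the class where
      stability applies.\<close>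
    have eta: "tame (moment Lsq \<psi>in) (\<lambda>i. \<eta> i t)" if "0 \<le> t" for t
      using classical_solution_evolves(1)[OF sol] moment that by blast
    have eta_ev: "evolves \<eta> \<eta>"
      using classical_solution_evolves(2)[OF sol] moment by blast
    have eta_init: "\<eta> i 0 = \<psi>in i" if "1 \<le> i" for i
      using classical_solution_evolves(3)[OF sol] moment that by blast
    show ?thesis
    proof (rule evolves_unique[OF _ eta_ev _ ev _ C(1) it])
      show "tame C (\<lambda>i. \<eta> i t)" "tame C (\<lambda>i. \<psi> i t)" if "0 \<le> t" for t
        using eta[OF that] tame[OF that] C(2) by (blast intro: tame_mono)+
    qed (use eta_init init in auto)
  qed
  have "\<forall>t\<ge>0. finite_moment Lsq (\<lambda>i. \<psi> i t) \<and> moment Lsq (\<lambda>i. \<psi> i t) \<le> moment Lsq \<psi>in"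
    using tame unfolding tame_def by blast
  with sol unique show ?thesis by blast
qed

end
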